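(* Let $\{S_k\}_{k\ge 0}$ be a simple random walk on $\mathbb{Z}^2$ started at $S_0=0$. For $0<\alpha<1$ and $n\in\mathbb{N}$ let $$\Psi_n(\alpha):=\Big\{x\in D(0,n): K(\tau_n,x)\ge \Big\lceil \tfrac{4\alpha}{\pi}(\log n)^2\Big\rceil\Big\}.$$ Then for any $0<\alpha,\beta<1$, $$\lim_{n\to\infty}\frac{\log E\big[\big|\{(x,x')\in\Psi_n(\alpha)^2: d(x,x')\le n^{\beta}\}\big|\big]}{\log n}=\hat\rho_2(\alpha,\beta),$$ where $$\hat\rho_2(\alpha,\beta):=\begin{cases}2+2\beta-\frac{4\alpha}{2-\beta}, & \beta\le 2-\sqrt{2\alpha},\\ 6-4\sqrt{2\alpha}, & \beta\ge 2-\sqrt{2\alpha}.\end{cases}$$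
   Context: $d$ is the Euclidean distance on $\mathbb{Z}^2$; $D(x,r):=\{y\in\mathbb{Z}^2: d(x,y)\le r\}$. For $G\subset\mathbb{Z}^2$, $\partial G:=\{y\in G^c: d(x,y)=1\text{ for some }x\in G\}$. $K(m,x):=\sum_{i=0}^m 1_{\{S_i=x\}}$ is the number of visits to $x$ up to time $m$, and $\tau_n:=\inf\{m\ge 0: S_m\in\partial D(0,n)\}$. $\lceil a\rceil$ is the smallest integer $\ge a$. $E$ denotes expectation for the walk started at $0$. *)

theory Defs
  imports "HOL-Probability.Probability"
begin

type_synonym pt = "int \<times> int"

definition srw_steps :: "pt set" where
  "srw_steps = {(1,0), (-1,0), (0,1), (0,-1)}"

definition srw_space :: "(pt stream) measure" where
  "srw_space = stream_space (measure_pmf (pmf_of_set srw_steps))"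

definition walk :: "pt stream \<Rightarrow> nat \<Rightarrow> pt" where
  "walk \<omega> m = ((\<Sum>i<m. fst (\<omega> !! i)), (\<Sum>i<m. snd (\<omega> !! i)))"

definition zdist :: "pt \<Rightarrow> pt \<Rightarrow> real" where
  "zdist x y = sqrt (real_of_int ((fst x - fst y)^2 + (snd x - snd y)^2))"

definition zdisc :: "pt \<Rightarrow> real \<Rightarrow> pt set" where
  "zdisc x r = {y. zdist x y \<le> r}"

definition zbd :: "pt set \<Rightarrow> pt set" where
  "zbd G = {y. y \<notin> G \<and> (\<exists>x\<in>G. zdist x y = 1)}"

definition hit_time :: "nat \<Rightarrow> pt stream \<Rightarrow> nat" where
  "hit_time n \<omega> = (LEAST m. walk \<omega> m \<in> zbd (zdisc (0,0) (real n)))"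

definition visits :: "pt stream \<Rightarrow> nat \<Rightarrow> pt \<Rightarrow> nat" where
  "visits \<omega> m x = card {i. i \<le> m \<and> walk \<omega> i = x}"

definition Psi :: "nat \<Rightarrow> real \<Rightarrow> pt stream \<Rightarrow> pt set" where
  "Psi n \<alpha> \<omega> = {x \<in> zdisc (0,0) (real n).
      int (visits \<omega> (hit_time n \<omega>) x) \<ge> \<lceil>4 * \<alpha> / pi * (ln (real n))^2\<rceil>}"

definition close_pairs :: "nat \<Rightarrow> real \<Rightarrow> real \<Rightarrow> pt stream \<Rightarrow> nat" where
  "close_pairs n \<alpha> \<beta> \<omega> = card {(x, x'). x \<in> Psi n \<alpha> \<omega> \<and> x' \<in> Psi n \<alpha> \<omega>
      \<and> zdist x x' \<le> real n powr \<beta>}"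

definition rho2 :: "real \<Rightarrow> real \<Rightarrow> real" where
  "rho2 \<alpha> \<beta> = (if \<beta> \<le> 2 - sqrt (2 * \<alpha>) then 2 + 2 * \<beta> - 4 * \<alpha> / (2 - \<beta>)
                 else 6 - 4 * sqrt (2 * \<alpha>))"

end

(*
  With potential kernel pot z ~ (2/pi) ln |z|, two points at distance n^g in the disc are
  visited k = (4 alpha/pi) (ln n)^2 times each with probability n^(-4 alpha/(2-g) + o(1)): the
  number of visits to the pair has a geometric tail of rate 1/(A + B), where A = (2/pi) ln n and
  B = (1-g) A are the values of the Green function on and off the diagonal. There are n^(2+2g)
  such pairs, and 2 + 2g - 4 alpha/(2-g) is maximal over g <= beta at g = min beta (2 - sqrt (2 alpha)).

  Neither Green functions nor the strong Markov property are needed: the probabilities satisfy a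
  first-step recursion, which is compared with explicit super- and subsolutions built from the
  potential kernel. In the upper bound 4 alpha/(2-g) >= 2 + 2g - rho2 turns the tail into
  n^(rho2-2) |z|^(-2), whose sum over z is only logarithmic, so no decomposition into scales occurs.
  In the lower bound one sums over the number of crossings between the two points; balancing the two
  visit counts costs only a factor 1/k by Cauchy-Schwarz.
*)

theory Submission
  imports Defs
begin

section \<open>The potential kernel of the planar walk\<close>

text \<open>Errors of order 1 in the kernel are harmless: with A of order ln n, k of order (ln n)^2
  and a tail exp (- 2 k / (A + B)), shifting A or B by a constant changes the exponent by O(1) and
  the probability by a constant factor. So \<open>pot\<close> is needed only as (2/pi) ln |z| +
  O(1), with crude constants. The obstacle is that \<open>pot\<close> is not constant on the
  boundary of the disc, so the Green function is not explicit. The comparison functions use a lower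
  or an upper bound of \<open>pot\<close> there instead, again at a cost of O(1). In the lower bound
  the walk must also reach the pair from 0. Pairs at distance n^(1 - \<delta>) from 0 are reached
  with probability at least of order \<delta>, which beats the O(1 / ln n) error of the kernel; the
  price is a factor n^(- 2 \<delta>) in the number of pairs, with \<delta> small against \<epsilon>.
  All recursions have a finite horizon. A supersolution bounds every horizon at once, whereas a
  subsolution needs a correction decaying geometrically in the horizon, since the walk may still be
  inside the disc at its end.\<close>

text \<open>Fourier inversion in the second coordinate only: for \<open>cosh s + cos t = 2\<close> the function
  \<open>exp (- s \<bar>x\<bar>) * cos (y t)\<close> is discrete harmonic off the line \<open>x = 0\<close>.
  Here \<open>sg t = sinh s\<close> and \<open>xi t = exp (- s)\<close>. At \<open>t = 0\<close> the integrand is the junk value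
  \<open>0 / 0 = 0\<close>.\<close>

definition sg :: "real \<Rightarrow> real" where
  "sg t = sqrt ((1 - cos t) * (3 - cos t))"

definition xi :: "real \<Rightarrow> real" where
  "xi t = 2 - cos t - sg t"

definition kern :: "int \<Rightarrow> int \<Rightarrow> real \<Rightarrow> real" where
  "kern x y t = (1 - xi t ^ nat \<bar>x\<bar> * cos (of_int y * t)) / sg t"

definition pot :: "pt \<Rightarrow> real" where
  "pot z = 2 / pi * integral {0..pi} (kern (fst z) (snd z))"

lemma cos_le_3 [simp]: "cos (t::real) \<le> 3"
  using cos_le_one[of t] by linarith

lemma sg_square: "(sg t)\<^sup>2 = (1 - cos t) * (3 - cos t)"
  unfolding sg_def
  by (subst real_sqrt_pow2) (use cos_le_one[of t] in \<open>auto intro!: mult_nonneg_nonneg\<close>)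

lemma sg_nonneg: "0 \<le> sg t"
  unfolding sg_def using cos_le_one[of t] by (auto intro!: mult_nonneg_nonneg)

lemma xi_inverse: "xi t * (2 - cos t + sg t) = 1"
  using sg_square[of t] by (simp add: xi_def algebra_simps power2_eq_square)

lemma xi_pos: "0 < xi t"
proof -
  have "0 < 2 - cos t + sg t" using cos_le_one[of t] sg_nonneg[of t] by linarith
  then show ?thesis using xi_inverse[of t] by (metis zero_less_mult_pos2 zero_less_one)
qed

lemma xi_le_inverse: "xi t \<le> 1 / (1 + sg t)"
proof -
  have "xi t * (1 + sg t) \<le> xi t * (2 - cos t + sg t)"
    using cos_le_one[of t] xi_pos[of t] by (intro mult_left_mono) auto
  then show ?thesis using xi_inverse[of t] sg_nonneg[of t] by (simp add: field_simps)
qed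

lemma xi_le_1: "xi t \<le> 1"
  by (rule order_trans[OF xi_le_inverse]) (use sg_nonneg[of t] in simp)

lemma sg_ge_sin: "0 \<le> t \<Longrightarrow> t \<le> pi \<Longrightarrow> 2 * sin (t/2) \<le> sg t"
proof -
  assume t: "0 \<le> t" "t \<le> pi"
  have c: "1 - cos t = 2 * (sin (t/2))\<^sup>2" using cos_double_sin[of "t/2"] by simp
  have "(2 * sin (t/2))\<^sup>2 = 2 * (1 - cos t)" unfolding c by (simp add: power2_eq_square)
  also have "\<dots> \<le> (sg t)\<^sup>2"
    unfolding sg_square mult.commute[of 2] by (rule mult_left_mono) (use cos_le_one[of t] in auto)
  finally show ?thesis by (rule power2_le_imp_le) (rule sg_nonneg)
qed

lemma sin_ge_cubic: 
  fixes x :: real assumes "0 \<le> x" shows "x - x^3/6 \<le> sin x"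
proof -
  have "(\<Sum>m<3. sin_coeff m * x ^ m) = x" by (simp add: sin_coeff_def eval_nat_numeral)
  moreover have "inverse (fact 3) * \<bar>x\<bar> ^ 3 = x^3/6" using assms by (simp add: fact_numeral)
  ultimately have "\<bar>sin x - x\<bar> \<le> x^3/6" using Maclaurin_sin_bound[of x 3] by simp
  then show ?thesis by linarith
qed

text \<open>12 is the threshold up to which \<open>t - t^3/24\<close> dominates \<open>t/2\<close>,
  so \<open>sg\<close> has a linear lower bound on all of [0, pi].\<close>

lemma pi_square_le: "t \<le> pi \<Longrightarrow> 0 \<le> t \<Longrightarrow> t\<^sup>2 \<le> 12"
proof -
  assume "t \<le> pi" "0 \<le> t"
  then have "t \<le> 3.2" using pi_approx by simp
  then have "t\<^sup>2 \<le> 3.2\<^sup>2" using \<open>0 \<le> t\<close> by (intro power_mono) auto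
  then show ?thesis by (simp add: power2_eq_square)
qed

lemma sg_ge_cubic: "0 \<le> t \<Longrightarrow> t \<le> pi \<Longrightarrow> t - t^3/24 \<le> sg t"
  using sg_ge_sin[of t] sin_ge_cubic[of "t/2"] by (simp add: field_simps)

lemma sg_ge_half: "0 \<le> t \<Longrightarrow> t \<le> pi \<Longrightarrow> t/2 \<le> sg t"
proof -
  assume t: "0 \<le> t" "t \<le> pi"
  have "t * t\<^sup>2 \<le> t * 12" using t pi_square_le by (intro mult_left_mono) auto
  then show ?thesis using sg_ge_cubic[OF t] by (simp add: power3_eq_cube power2_eq_square)
qed

lemma one_minus_cos_le: "1 - cos t \<le> (t::real)\<^sup>2/2"
proof -
  have c: "1 - cos t = 2 * (sin (t/2))\<^sup>2" using cos_double_sin[of "t/2"] by simp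
  have "\<bar>sin (t/2)\<bar>\<^sup>2 \<le> \<bar>t/2\<bar>\<^sup>2" using abs_sin_x_le_abs_x[of "t/2"] by (rule power_mono) simp
  then have "(sin (t/2))\<^sup>2 \<le> (t/2)\<^sup>2" by (simp only: power2_abs)
  then show ?thesis unfolding c by (simp only: power_divide) simp
qed

lemma sg_le: "0 \<le> t \<Longrightarrow> sg t \<le> t + t^3/8"
proof -
  assume t: "0 \<le> t"
  have "(sg t)\<^sup>2 \<le> (t\<^sup>2/2) * (2 + t\<^sup>2/2)"
    unfolding sg_square using one_minus_cos_le[of t] cos_le_one[of t] by (intro mult_mono) auto
  also have "\<dots> \<le> (t + t^3/8)\<^sup>2"
  proof -
    have "(t + t^3/8)\<^sup>2 = (t\<^sup>2/2) * (2 + t\<^sup>2/2) + (t^3/8)\<^sup>2"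
      by (simp add: power2_eq_square power3_eq_cube algebra_simps)
    then show ?thesis using zero_le_power2[of "t^3/8"] by linarith
  qed
  finally show ?thesis by (rule power2_le_imp_le) (use t in simp)
qed

text \<open>\<open>t - sg t\<close> is of third order and \<open>t * sg t\<close> of second order,
  so the difference stays bounded. This isolates the singularity that produces the
  logarithm.\<close>

lemma inverse_sg_diff: "0 < t \<Longrightarrow> t \<le> pi \<Longrightarrow> \<bar>1 / sg t - 1 / t\<bar> \<le> 1"
proof -
  assume t: "0 < t" "t \<le> pi"
  have h: "t/2 \<le> sg t" and l: "t - t^3/24 \<le> sg t" and u: "sg t \<le> t + t^3/8"
    using t sg_ge_half sg_ge_cubic sg_le by auto
  have p: "0 < sg t" using h t by linarith
  have t4: "t \<le> 4" using t pi_approx by simp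
  have "\<bar>t - sg t\<bar> \<le> t^3/8" using l u t zero_le_power[of t 3] by linarith
  also have "\<dots> \<le> t * (t/2)" using t t4
    by (simp add: power3_eq_cube field_simps)
  also have "\<dots> \<le> t * sg t" using h t by (intro mult_left_mono) auto
  finally have "\<bar>t - sg t\<bar> \<le> t * sg t" .
  moreover have tp: "0 < t * sg t" using t p by (rule_tac mult_pos_pos) auto
  ultimately have "\<bar>t - sg t\<bar> / (t * sg t) \<le> 1" by (simp only: pos_divide_le_eq mult_1)
  moreover have "1 / sg t - 1 / t = (t - sg t) / (t * sg t)" using t p by (simp add: field_simps)
  ultimately show ?thesis using tp by (simp only: abs_divide abs_of_pos)
qed

lemma sg_mono: "0 \<le> s \<Longrightarrow> s \<le> t \<Longrightarrow> t \<le> pi \<Longrightarrow> sg s \<le> sg t"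
proof -
  assume "0 \<le> s" "s \<le> t" "t \<le> pi"
  then have "cos t \<le> cos s" by (intro cos_monotone_0_pi_le) auto
  then have "(1 - cos s) * (3 - cos s) \<le> (1 - cos t) * (3 - cos t)"
    using cos_le_one[of s] cos_le_one[of t] by (intro mult_mono) auto
  then show ?thesis by (simp add: sg_def)
qed

lemma xi_antimono: "0 \<le> s \<Longrightarrow> s \<le> t \<Longrightarrow> t \<le> pi \<Longrightarrow> xi t \<le> xi s"
proof -
  assume a: "0 \<le> s" "s \<le> t" "t \<le> pi"
  then have "cos t \<le> cos s" by (intro cos_monotone_0_pi_le) auto
  then have "2 - cos s + sg s \<le> 2 - cos t + sg t" using sg_mono[OF a] by simp
  then have "xi t * (2 - cos s + sg s) \<le> xi t * (2 - cos t + sg t)"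
    using xi_pos[of t] by (intro mult_left_mono) auto
  also have "\<dots> = xi s * (2 - cos s + sg s)" using xi_inverse by simp
  finally show ?thesis
    by (rule mult_right_le_imp_le) (use cos_le_one[of s] sg_nonneg[of s] in linarith)
qed

lemma xi_power_cos_bound: "\<bar>xi t ^ m * cos u\<bar> \<le> 1"
proof -
  have "\<bar>xi t ^ m\<bar> \<le> 1" using xi_pos[of t] xi_le_1[of t] by (simp add: power_le_one)
  then show ?thesis using abs_cos_le_one[of u] by (simp add: abs_mult mult_le_one)
qed

lemma kern_nonneg: "0 \<le> kern x y t"
  unfolding kern_def using xi_power_cos_bound[of t "nat \<bar>x\<bar>" "of_int y * t"] sg_nonneg[of t]
  by (intro divide_nonneg_nonneg) (auto simp: abs_le_iff)

text \<open>Both parts of the numerator contain a factor \<open>sg t\<close>: Bernoulli gives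
  \<open>1 - xi t ^ m \<le> m * sg t\<close>, and 1 - cos (y t) \<le> y^2 t^2 / 2 contains t/2 \<le>
  sg t. Dividing leaves a bound without singularity.\<close>

lemma kern_le:
  assumes t: "0 \<le> t" "t \<le> pi"
  shows "kern x y t \<le> of_int \<bar>x\<bar> + of_int (y\<^sup>2) * t"
proof (cases "t = 0")
  case True then show ?thesis by (simp add: kern_def sg_def)
next
  case False
  have h: "t/2 \<le> sg t" using t sg_ge_half by auto
  have p: "0 < sg t" using h t False by linarith
  have a: "1 - xi t ^ m \<le> m * sg t" for m
  proof -
    have "1 + real m * (xi t - 1) \<le> (1 + (xi t - 1)) ^ m"
      using xi_pos[of t] by (intro Bernoulli_inequality) auto
    then have "1 - xi t ^ m \<le> m * (1 - xi t)" by (simp add: algebra_simps)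
    also have "\<dots> \<le> m * sg t" using cos_le_one[of t] by (intro mult_left_mono) (auto simp: xi_def)
    finally show ?thesis .
  qed
  let ?m = "nat \<bar>x\<bar>" and ?u = "of_int y * t"
  have "1 - xi t ^ ?m * cos ?u = (1 - xi t ^ ?m) + xi t ^ ?m * (1 - cos ?u)" by (simp add: algebra_simps)
  also have "\<dots> \<le> ?m * sg t + 1 * (?u\<^sup>2/2)"
    using xi_pos[of t] xi_le_1[of t]
    by (intro add_mono mult_mono one_minus_cos_le a) (auto simp: power_le_one)
  also have "\<dots> \<le> ?m * sg t + (of_int (y\<^sup>2) * t) * sg t"
  proof -
    have "?u\<^sup>2/2 = (of_int (y\<^sup>2) * t) * (t/2)" by (simp add: power2_eq_square)
    also have "\<dots> \<le> (of_int (y\<^sup>2) * t) * sg t" using h t by (intro mult_left_mono) auto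
    finally show ?thesis by simp
  qed
  also have "\<dots> = (of_int \<bar>x\<bar> + of_int (y\<^sup>2) * t) * sg t" by (simp add: algebra_simps)
  finally show ?thesis by (simp only: kern_def pos_divide_le_eq[OF p])
qed

lemma sg_pos: "0 < t \<Longrightarrow> t \<le> pi \<Longrightarrow> 0 < sg t"
  using sg_ge_half[of t] by linarith

lemma continuous_on_sg: "continuous_on S sg"
  unfolding sg_def by (intro continuous_intros)

lemma integrable_on_Ioc_iff:
  fixes f :: "real \<Rightarrow> real"
  shows "f integrable_on {a<..b} \<longleftrightarrow> f integrable_on {a..b}"
  by (rule integrable_spike_set_eq, rule negligible_subset[OF negligible_sing[of a]]) auto

lemma kern_integrable: "kern x y integrable_on {0..pi}"
proof -
  \<comment> \<open>At t = 0 the kernel has the value 0 while its limit is |x|, so continuity is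
    used only on the half-open interval.\<close>
  have "kern x y integrable_on {0<..pi}"
  proof (rule measurable_bounded_by_integrable_imp_integrable)
    show "kern x y \<in> borel_measurable (lebesgue_on {0<..pi})"
    proof (rule continuous_imp_measurable_on_sets_lebesgue)
      have "sg t \<noteq> 0" if "t \<in> {0<..pi}" for t using that sg_pos[of t] by auto
      then show "continuous_on {0<..pi} (kern x y)"
        unfolding kern_def xi_def by (intro continuous_intros continuous_on_sg ballI) blast
    qed simp
    have "(\<lambda>t. of_int \<bar>x\<bar> + of_int (y\<^sup>2) * t) integrable_on {0..pi}"
      by (intro integrable_continuous_interval continuous_intros)
    then show "(\<lambda>t. of_int \<bar>x\<bar> + of_int (y\<^sup>2) * t) integrable_on {0<..pi}"
      by (simp add: integrable_on_Ioc_iff)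
    show "norm (kern x y t) \<le> of_int \<bar>x\<bar> + of_int (y\<^sup>2) * t" if "t \<in> {0<..pi}" for t
      using that kern_le[of t x y] kern_nonneg[of x y t] by simp
  qed auto
  then show ?thesis
    by (simp add: integrable_on_Ioc_iff)
qed

lemma pot_nonneg: "0 \<le> pot z"
  unfolding pot_def by (intro mult_nonneg_nonneg integral_nonneg kern_integrable kern_nonneg) auto

lemma pot_uminus: "pot (-x, -y) = pot (x, y)"
  by (simp add: pot_def kern_def[abs_def])

lemma pot_0: "pot (0,0) = 0"
  by (simp add: pot_def kern_def[abs_def])

lemma integral_cos_int: "integral {0..pi} (\<lambda>t. cos (of_int y * t)) = (if y = 0 then pi else 0)"
proof (cases "y = 0")
  case False
  have "((\<lambda>t. cos (of_int y * t)) has_integral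
     (sin (of_int y * pi) / of_int y - sin (of_int y * 0) / of_int y)) {0..pi}"
    by (rule fundamental_theorem_of_calculus)
       (use False in \<open>auto intro!: derivative_eq_intros simp: has_real_derivative_iff_has_vector_derivative[symmetric]\<close>)
  moreover have "sin (of_int y * pi) = 0" by (simp add: mult.commute sin_times_pi_eq_0)
  ultimately show ?thesis using False by (simp add: integral_unique)
qed simp

text \<open>Off the line x = 0 this is X + 1/X = 4 - 2 cos t for X = \<open>xi t\<close>. On the
  line both horizontal neighbours carry X = 2 - cos t - sg t, and the defect 2 cos (y t) sg t loses
  its \<open>sg t\<close> in the division.\<close>

lemma kern_laplace:
  assumes t: "0 < t" "t \<le> pi"
  shows "kern (x+1) y t + kern (x-1) y t + kern x (y+1) t + kern x (y-1) t
    = 4 * kern x y t + (if x = 0 then 2 * cos (of_int y * t) else 0)"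
proof -
  define c where "c = cos (of_int y * t)"
  define X where "X = xi t"
  have p: "0 < sg t" using t sg_pos by auto
  have cc: "cos (of_int (y+1) * t) + cos (of_int (y-1) * t) = 2 * c * cos t"
    by (simp add: c_def algebra_simps cos_add cos_diff)
  have X: "X * (2 - cos t + sg t) = 1" "X = 2 - cos t - sg t" "0 < X"
    using xi_inverse xi_pos by (auto simp: X_def xi_def)
  have X2: "X\<^sup>2 + 1 = (4 - 2 * cos t) * X"
  proof -
    have "X * (2 - cos t + (2 - cos t - X)) = 1" using X(1,2) by simp
    then show ?thesis by (simp add: algebra_simps power2_eq_square)
  qed
  let ?m = "nat \<bar>x\<bar>"
  have "(kern (x+1) y t + kern (x-1) y t + kern x (y+1) t + kern x (y-1) t) * sg t
     = 4 - (X ^ nat \<bar>x+1\<bar> + X ^ nat \<bar>x-1\<bar>) * c - X ^ ?m * (2 * c * cos t)"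
    unfolding cc[symmetric] kern_def using p by (simp add: field_simps c_def X_def)
  also have "\<dots> = 4 * (1 - X ^ ?m * c) + (if x = 0 then 2 * c else 0) * sg t"
  proof (cases "x = 0")
    case True then show ?thesis by (simp add: X(2) algebra_simps)
  next
    case False
    then obtain k where k: "?m = Suc k" by (metis nat_eq_iff2 not0_implies_Suc zero_less_abs_iff nat_0_iff not_le)
    have "X ^ nat \<bar>x+1\<bar> + X ^ nat \<bar>x-1\<bar> = X ^ (k+2) + X ^ k"
    proof (cases "x > 0")
      case True
      then have "nat \<bar>x+1\<bar> = k + 2" "nat \<bar>x-1\<bar> = k" using k by auto
      then show ?thesis by (simp only:)
    next
      case F: False
      then have "nat \<bar>x+1\<bar> = k" "nat \<bar>x-1\<bar> = k+2" using k False by auto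
      then show ?thesis by (simp only: add.commute)
    qed
    also have "\<dots> = X ^ k * (X\<^sup>2 + 1)" by (simp add: algebra_simps power_add power2_eq_square)
    also have "\<dots> = X ^ ?m * (4 - 2 * cos t)" unfolding X2 k by simp
    finally show ?thesis using False by (simp only:) (simp add: algebra_simps)
  qed
  also have "\<dots> = (4 * kern x y t + (if x = 0 then 2 * c else 0)) * sg t"
  proof -
    have "kern x y t * sg t = 1 - X ^ ?m * c" using p by (simp add: kern_def c_def X_def)
    then show ?thesis by (simp only: distrib_right mult.assoc)
  qed
  finally show ?thesis using p by (simp add: c_def)
qed

text \<open>By orthogonality of the cosines the source on x = 0 integrates to 2 pi at y = 0 and to 0
  elsewhere; the factor 2/pi in \<open>pot\<close> makes it 4, a unit source for the mean over four
  neighbours.\<close>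

lemma pot_laplace:
  "pot (x+1,y) + pot (x-1,y) + pot (x,y+1) + pot (x,y-1) = 4 * pot (x,y) + (if x = 0 \<and> y = 0 then 4 else 0)"
proof -
  note I = kern_integrable
  have "integral {0..pi} (kern (x+1) y) + integral {0..pi} (kern (x-1) y) + integral {0..pi} (kern x (y+1))
     + integral {0..pi} (kern x (y-1))
   = integral {0..pi} (\<lambda>t. kern (x+1) y t + kern (x-1) y t + kern x (y+1) t + kern x (y-1) t)"
    using I by (simp add: integral_add integrable_add)
  also have "\<dots> = integral {0..pi} (\<lambda>t. 4 * kern x y t + (if x = 0 then 2 * cos (of_int y * t) else 0))"
    by (rule integral_spike[of "{0}"]) (auto simp: kern_laplace)
  also have "\<dots> = 4 * integral {0..pi} (kern x y) + integral {0..pi} (\<lambda>t. if x = 0 then 2 * cos (of_int y * t) else 0)"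
    using I by (cases "x = 0"; subst integral_add)
      (auto intro!: integrable_continuous_interval continuous_intros)
  also have "integral {0..pi} (\<lambda>t. if x = 0 then 2 * cos (of_int y * t) else 0) = (if x = 0 \<and> y = 0 then 2 * pi else 0)"
    using integral_cos_int[of y] by (cases "x = 0") auto
  finally have *: "integral {0..pi} (kern (x+1) y) + integral {0..pi} (kern (x-1) y) + integral {0..pi} (kern x (y+1))
     + integral {0..pi} (kern x (y-1)) = 4 * integral {0..pi} (kern x y) + (if x = 0 \<and> y = 0 then 2 * pi else 0)" .
  show ?thesis unfolding pot_def fst_conv snd_conv distrib_left[symmetric] * by (simp add: field_simps)
qed

section \<open>Logarithmic growth of the potential kernel\<close>

lemma inverse_le_pi: "1 \<le> N \<Longrightarrow> 0 < 1/N" "1 \<le> N \<Longrightarrow> 1/N \<le> 1" "1 \<le> N \<Longrightarrow> 1/N \<le> pi"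
  for N :: real
  using pi_gt3 by (auto simp: divide_le_eq_1 intro: order_trans[of _ 1])

lemma integral_inverse_sg:
  assumes e: "0 < e" "e \<le> pi"
  shows "(\<lambda>t. 1 / sg t) integrable_on {e..pi}"
    and "\<bar>integral {e..pi} (\<lambda>t. 1 / sg t) + ln e\<bar> \<le> 6"
proof -
  have nz: "sg t \<noteq> 0" if "t \<in> {e..pi}" for t using that sg_pos[of t] e by auto
  show i: "(\<lambda>t. 1 / sg t) integrable_on {e..pi}"
    using nz by (intro integrable_continuous_interval continuous_intros continuous_on_sg) blast
  have l: "((\<lambda>t. 1 / t) has_integral (ln pi - ln e)) {e..pi}"
  proof (rule fundamental_theorem_of_calculus[OF e(2)])
    fix t assume "t \<in> {e..pi}"
    then have "(ln has_real_derivative 1 / t) (at t within {e..pi})"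
      using e by (auto intro!: derivative_eq_intros)
    then show "(ln has_vector_derivative 1 / t) (at t within {e..pi})"
      by (simp add: has_real_derivative_iff_has_vector_derivative)
  qed
  have "\<bar>integral {e..pi} (\<lambda>t. 1 / sg t - 1 / t)\<bar> \<le> integral {e..pi} (\<lambda>t. 1)"
    unfolding real_norm_def[symmetric]
    by (rule integral_norm_bound_integral)
       (use i l inverse_sg_diff e in \<open>auto intro!: integrable_diff dest: has_integral_integrable\<close>)
  also have "\<dots> \<le> pi" using e by simp
  finally have "\<bar>integral {e..pi} (\<lambda>t. 1 / sg t) - (ln pi - ln e)\<bar> \<le> pi"
    using i l by (simp add: integral_diff has_integral_integrable integral_unique)
  moreover have "0 \<le> ln pi" "ln pi \<le> pi - 1" using pi_gt3 ln_le_minus_one[of pi] by auto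
  moreover have "pi \<le> 3.2" using pi_approx by simp
  ultimately show "\<bar>integral {e..pi} (\<lambda>t. 1 / sg t) + ln e\<bar> \<le> 6" by linarith
qed

lemma integral_kern_near_0:
  fixes N :: real
  assumes N: "1 \<le> N" "of_int \<bar>x\<bar> \<le> N" "of_int \<bar>y\<bar> \<le> N"
  shows "0 \<le> integral {0..1/N} (kern x y)" "integral {0..1/N} (kern x y) \<le> 2"
proof -
  have e: "0 < 1/N" "1/N \<le> 1" "1/N \<le> pi" using N(1) by (auto intro!: inverse_le_pi)
  have i: "kern x y integrable_on {0..1/N}"
    by (rule integrable_subinterval_real[OF kern_integrable]) (use e in auto)
  show "0 \<le> integral {0..1/N} (kern x y)" by (intro integral_nonneg i kern_nonneg)
  have "integral {0..1/N} (kern x y) \<le> integral {0..1/N} (\<lambda>t. 2 * N)"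
  proof (rule integral_le[OF i])
    fix t assume t: "t \<in> {0..1/N}"
    have "of_int (y\<^sup>2) \<le> N\<^sup>2"
      using N(3) power_mono[of "of_int \<bar>y\<bar>" N 2] by (simp add: power2_abs)
    then have "of_int (y\<^sup>2) * t \<le> N\<^sup>2 * (1/N)" using t by (intro mult_mono) auto
    also have "\<dots> = N" using N by (simp add: power2_eq_square)
    finally show "kern x y t \<le> 2 * N" using kern_le[of t x y] t e N(2) by auto
  qed (rule integrable_const_ivl)
  also have "\<dots> = 2" using N by simp
  finally show "integral {0..1/N} (kern x y) \<le> 2" .
qed

lemma integral_cos_abs_le:
  assumes "0 < (y::real)" "a \<le> b"
  shows "\<bar>integral {a..b} (\<lambda>t. cos (y * t))\<bar> \<le> 2 / y"
proof -
  have "((\<lambda>t. cos (y * t)) has_integral (sin (y * b) / y - sin (y * a) / y)) {a..b}"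
    by (rule fundamental_theorem_of_calculus[OF assms(2)])
       (use assms in \<open>auto intro!: derivative_eq_intros simp: has_real_derivative_iff_has_vector_derivative[symmetric]\<close>)
  then have "integral {a..b} (\<lambda>t. cos (y * t)) = (sin (y * b) - sin (y * a)) / y"
    by (simp add: integral_unique diff_divide_distrib)
  moreover have "\<bar>sin (y * b) - sin (y * a)\<bar> \<le> 2"
    using abs_sin_le_one[of "y * b"] abs_sin_le_one[of "y * a"] by linarith
  ultimately show ?thesis using assms by (simp add: divide_right_mono)
qed

text \<open>When |y| is the larger coordinate, the damping by \<open>xi\<close> may be absent (x =
  0) and only oscillation helps. The amplitude decreases and is at most 2 |y| from 1/|y| on, an
  integral of cos (y t) is at most 2/|y|, and the second mean value theorem leaves two such
  products.\<close>

lemma oscillating_bound_vertical: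
  fixes x y :: int and m :: nat
  assumes y: "1 \<le> \<bar>y\<bar>"
  defines "e \<equiv> 1 / of_int \<bar>y\<bar>"
  shows "\<bar>integral {e..pi} (\<lambda>t. xi t ^ m / sg t * cos (of_int y * t))\<bar> \<le> 8"
proof -
  let ?Y = "real_of_int \<bar>y\<bar>"
  have Y: "1 \<le> ?Y" using y by simp
  have e: "0 < e" "e \<le> 1" "e \<le> pi" unfolding e_def using Y by (auto intro!: inverse_le_pi)
  define w where "w t = xi t ^ m / sg t" for t
  have w_mono: "w t \<le> w s" if "e \<le> s" "s \<le> t" "t \<le> pi" for s t
    unfolding w_def using that e sg_pos[of s] xi_pos[of t] xi_pos[of s]
    by (intro frac_le power_mono xi_antimono sg_mono) auto
  have w_bound: "0 \<le> w t" "w t \<le> 2 * ?Y" if "e \<le> t" "t \<le> pi" for t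
  proof -
    have p: "0 < sg e" using e sg_pos by auto
    show "0 \<le> w t" unfolding w_def using that e xi_pos[of t] sg_nonneg by (intro divide_nonneg_nonneg) auto
    have "w t \<le> w e" using that by (intro w_mono) auto
    also have "\<dots> \<le> 1 / sg e" unfolding w_def using p xi_pos[of e] xi_le_1[of e]
      by (intro divide_right_mono) (auto simp: power_le_one)
    also have "\<dots> \<le> 1 / (e/2)" using sg_ge_half[of e] e p by (intro divide_left_mono) auto
    finally show "w t \<le> 2 * ?Y" by (simp add: e_def)
  qed
  have c: "cos (of_int y * t) = cos (?Y * t)" for t by (cases "y < 0") auto
  \<comment> \<open>The theorem takes a nondecreasing weight, hence \<open>- w t\<close>.\<close>
  obtain c where cc: "c \<in> {e..pi}"
    and I: "integral {e..pi} (\<lambda>t. - w t * cos (?Y * t)) =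
      - w e * integral {e..c} (\<lambda>t. cos (?Y * t)) + - w pi * integral {c..pi} (\<lambda>t. cos (?Y * t))"
    by (rule second_mean_value_theorem[of "\<lambda>t. cos (?Y * t)" e pi "\<lambda>t. - w t"])
       (use e w_mono in \<open>auto intro!: integrable_continuous_interval continuous_intros\<close>)
  have b: "\<bar>w t * integral {s..r} (\<lambda>t. cos (?Y * t))\<bar> \<le> 4" if "e \<le> t" "t \<le> pi" "s \<le> r" for t s r
  proof -
    have "\<bar>w t\<bar> * \<bar>integral {s..r} (\<lambda>t. cos (?Y * t))\<bar> \<le> (2 * ?Y) * (2 / ?Y)"
      using w_bound[OF that(1,2)] integral_cos_abs_le[of ?Y s r] that Y
      by (intro mult_mono) auto
    also have "\<dots> = 4" using Y by simp
    finally show ?thesis by (simp add: abs_mult)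
  qed
  have "integral {e..pi} (\<lambda>t. xi t ^ m / sg t * cos (of_int y * t)) = - integral {e..pi} (\<lambda>t. - w t * cos (?Y * t))"
    unfolding c w_def by simp
  also have "\<bar>\<dots>\<bar> \<le> 8"
    unfolding I using b[of e e c] b[of pi c pi] cc e by (simp add: abs_le_iff)
  finally show ?thesis .
qed

text \<open>When |x| is the larger coordinate, oscillation may be absent (y = 0) and damping
  suffices: Bernoulli for (1 + sg t)^m gives the bound 4 / (m t^2), whose integral from 1/m on is at
  most 4.\<close>

lemma oscillating_bound_horizontal:
  fixes y :: int and m :: nat
  assumes m: "1 \<le> m"
  defines "e \<equiv> 1 / real m"
  shows "\<bar>integral {e..pi} (\<lambda>t. xi t ^ m / sg t * cos (of_int y * t))\<bar> \<le> 4"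
proof -
  have e: "0 < e" "e \<le> 1" "e \<le> pi" unfolding e_def using m by (auto intro!: inverse_le_pi)
  have nz: "sg t \<noteq> 0" if "t \<in> {e..pi}" for t using that sg_pos[of t] e by auto
  have B: "xi t ^ m / sg t \<le> 4 / (real m * t\<^sup>2)" if t: "t \<in> {e..pi}" for t
  proof -
    have h: "0 < t" "t/2 \<le> sg t" "0 < sg t" using t e sg_ge_half[of t] sg_pos[of t] by auto
    have "xi t ^ m \<le> (1 / (1 + sg t)) ^ m" using xi_pos[of t] xi_le_inverse by (intro power_mono) auto
    also have "\<dots> = 1 / (1 + sg t) ^ m" by (simp add: power_one_over)
    also have "\<dots> \<le> 1 / (real m * sg t)"
    proof (rule divide_left_mono)
      have "1 + real m * sg t \<le> (1 + sg t) ^ m" using h by (intro Bernoulli_inequality) auto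
      then show "real m * sg t \<le> (1 + sg t) ^ m" by simp
    qed (use h m in auto)
    finally have "xi t ^ m / sg t \<le> 1 / (real m * sg t) / sg t" using h by (intro divide_right_mono) auto
    also have "\<dots> = 1 / (real m * (sg t)\<^sup>2)" by (simp add: power2_eq_square)
    also have "\<dots> \<le> 1 / (real m * (t/2)\<^sup>2)" using h m by (intro divide_left_mono mult_left_mono power_mono) auto
    also have "\<dots> = 4 / (real m * t\<^sup>2)" by (simp add: power_divide)
    finally show ?thesis .
  qed
  have J: "((\<lambda>t. 4 / (real m * t\<^sup>2)) has_integral (- 4 / (real m * pi) - (- 4 / (real m * e)))) {e..pi}"
  proof (rule fundamental_theorem_of_calculus[OF e(3)])
    fix t assume "t \<in> {e..pi}"
    then have "((\<lambda>t. - 4 / (real m * t)) has_real_derivative 4 / (real m * t\<^sup>2)) (at t within {e..pi})"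
      using e m by (auto intro!: derivative_eq_intros simp: power2_eq_square)
    then show "((\<lambda>t. - 4 / (real m * t)) has_vector_derivative 4 / (real m * t\<^sup>2)) (at t within {e..pi})"
      by (simp add: has_real_derivative_iff_has_vector_derivative)
  qed
  have "norm (integral {e..pi} (\<lambda>t. xi t ^ m / sg t * cos (of_int y * t))) \<le> integral {e..pi} (\<lambda>t. 4 / (real m * t\<^sup>2))"
  proof (rule integral_norm_bound_integral)
    show "(\<lambda>t. xi t ^ m / sg t * cos (of_int y * t)) integrable_on {e..pi}"
      unfolding xi_def using nz
      by (intro integrable_continuous_interval continuous_intros continuous_on_sg) blast
    show "(\<lambda>t. 4 / (real m * t\<^sup>2)) integrable_on {e..pi}" using J by (rule has_integral_integrable)
    fix t assume t: "t \<in> {e..pi}"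
    have "0 \<le> xi t ^ m / sg t" using xi_pos[of t] sg_nonneg by (intro divide_nonneg_nonneg) auto
    then have "norm (xi t ^ m / sg t * cos (of_int y * t)) \<le> xi t ^ m / sg t * 1"
      unfolding real_norm_def abs_mult by (intro mult_mono) auto
    then show "norm (xi t ^ m / sg t * cos (of_int y * t)) \<le> 4 / (real m * t\<^sup>2)" using B[OF t] by linarith
  qed
  also have "\<dots> = - 4 / (real m * pi) - (- 4 / (real m * e))" using J by (rule integral_unique)
  also have "\<dots> \<le> 4" using m by (simp add: e_def)
  finally show ?thesis by simp
qed

text \<open>After cutting at 1/N the errors are 2 (small t), 6 (\<open>1 / sg\<close> against the
  logarithm) and 8 (oscillating part), and 2/pi * 16 = 32/pi.\<close>

lemma pot_asymp_max:
  assumes z: "(x,y) \<noteq> (0,0)"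
  shows "\<bar>pot (x,y) - 2/pi * ln (of_int (max \<bar>x\<bar> \<bar>y\<bar>))\<bar> \<le> 32/pi"
proof -
  define N :: int where "N = max \<bar>x\<bar> \<bar>y\<bar>"
  define e where "e = 1 / real_of_int N"
  have N: "1 \<le> N" using z by (auto simp: N_def)
  then have N': "1 \<le> real_of_int N" by simp
  have e: "0 < e" "e \<le> 1" "e \<le> pi" unfolding e_def using N' by (auto intro!: inverse_le_pi)
  let ?m = "nat \<bar>x\<bar>"
  let ?osc = "\<lambda>t. xi t ^ ?m / sg t * cos (of_int y * t)"
  have osc: "\<bar>integral {e..pi} ?osc\<bar> \<le> 8"
  proof (cases "\<bar>x\<bar> \<le> \<bar>y\<bar>")
    case True
    then have "N = \<bar>y\<bar>" by (simp add: N_def)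
    then show ?thesis using oscillating_bound_vertical[of y ?m] N by (simp add: e_def)
  next
    case False
    then have "N = \<bar>x\<bar>" by (simp add: N_def)
    then show ?thesis using oscillating_bound_horizontal[of ?m y] N by (cases "x = 0") (auto simp: e_def Suc_le_eq)
  qed
  have near: "0 \<le> integral {0..e} (kern x y)" "integral {0..e} (kern x y) \<le> 2"
    unfolding e_def using N' by (auto intro!: integral_kern_near_0 simp: N_def)
  have nz: "sg t \<noteq> 0" if "t \<in> {e..pi}" for t using that sg_pos[of t] e by auto
  have io: "?osc integrable_on {e..pi}"
    unfolding xi_def using nz
    by (intro integrable_continuous_interval continuous_intros continuous_on_sg) blast
  have "integral {e..pi} (kern x y) = integral {e..pi} (\<lambda>t. 1 / sg t - ?osc t)"
    by (intro integral_cong) (simp add: kern_def diff_divide_distrib)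
  also have "\<dots> = integral {e..pi} (\<lambda>t. 1 / sg t) - integral {e..pi} ?osc"
    by (intro integral_diff io integral_inverse_sg e)
  finally have far: "integral {e..pi} (kern x y) = integral {e..pi} (\<lambda>t. 1 / sg t) - integral {e..pi} ?osc" .
  have "integral {0..pi} (kern x y) = integral {0..e} (kern x y) + integral {e..pi} (kern x y)"
    using Henstock_Kurzweil_Integration.integral_combine[OF _ _ kern_integrable, of e x y] e by simp
  then have "\<bar>integral {0..pi} (kern x y) + ln e\<bar> \<le> 16"
    using near far osc integral_inverse_sg(2)[OF e(1,3)] by linarith
  then have I: "\<bar>integral {0..pi} (kern x y) - ln (of_int N)\<bar> \<le> 16"
    using N' by (simp add: e_def ln_div)
  have "pot (x,y) - 2/pi * ln (of_int N) = 2/pi * (integral {0..pi} (kern x y) - ln (of_int N))"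
    by (simp add: pot_def right_diff_distrib)
  also have "\<bar>\<dots>\<bar> \<le> 2/pi * 16" unfolding abs_mult using I by (intro mult_mono) auto
  finally show ?thesis by (simp add: N_def)
qed

lemma zdist_0_max:
  "of_int (max \<bar>x\<bar> \<bar>y\<bar>) \<le> zdist (x,y) (0,0)" "zdist (x,y) (0,0) \<le> 2 * of_int (max \<bar>x\<bar> \<bar>y\<bar>)"
proof -
  let ?N = "max \<bar>x\<bar> \<bar>y\<bar>"
  have a: "x\<^sup>2 \<le> ?N\<^sup>2" "y\<^sup>2 \<le> ?N\<^sup>2"
    using power_mono[of "\<bar>x\<bar>" ?N 2] power_mono[of "\<bar>y\<bar>" ?N 2] by auto
  have b: "?N\<^sup>2 \<le> x\<^sup>2 + y\<^sup>2" by (auto simp: max_def)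
  have "?N\<^sup>2 \<le> x\<^sup>2 + y\<^sup>2 \<Longrightarrow> real_of_int (?N\<^sup>2) \<le> real_of_int (x\<^sup>2 + y\<^sup>2)" by (simp only: of_int_le_iff)
  then have "(real_of_int ?N)\<^sup>2 \<le> real_of_int (x\<^sup>2 + y\<^sup>2)" using b by simp
  then show "of_int ?N \<le> zdist (x,y) (0,0)" by (auto simp: zdist_def intro: real_le_rsqrt)
  have "x\<^sup>2 + y\<^sup>2 \<le> 4 * ?N\<^sup>2" using a zero_le_power2[of ?N] by linarith
  then have "real_of_int (x\<^sup>2 + y\<^sup>2) \<le> real_of_int (4 * ?N\<^sup>2)" by (simp only: of_int_le_iff)
  also have "\<dots> = (2 * real_of_int ?N)\<^sup>2" by (simp add: power2_eq_square)
  finally show "zdist (x,y) (0,0) \<le> 2 * of_int ?N" by (auto simp: zdist_def intro!: real_le_lsqrt)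
qed

lemma pot_asymp:
  assumes z: "z \<noteq> (0,0)"
  shows "\<bar>pot z - 2/pi * ln (zdist z (0,0))\<bar> \<le> 12"
proof -
  obtain x y where xy: "z = (x,y)" by fastforce
  let ?N = "real_of_int (max \<bar>x\<bar> \<bar>y\<bar>)"
  have "1 \<le> max \<bar>x\<bar> \<bar>y\<bar>" using z xy by auto
  then have N: "1 \<le> ?N" by (simp only: of_int_1_le_iff)
  have d: "?N \<le> zdist z (0,0)" "zdist z (0,0) \<le> 2 * ?N" using zdist_0_max unfolding xy by auto
  have l: "ln ?N \<le> ln (zdist z (0,0))" using d N by (subst ln_le_cancel_iff) auto
  have "ln (zdist z (0,0)) \<le> ln (2 * ?N)" using d N by (subst ln_le_cancel_iff) auto
  also have "\<dots> \<le> 1 + ln ?N" using N ln_2_less_1 by (simp add: ln_mult)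
  finally have u: "ln (zdist z (0,0)) \<le> 1 + ln ?N" .
  have "\<bar>2/pi * ln (zdist z (0,0)) - 2/pi * ln ?N\<bar> = 2/pi * \<bar>ln (zdist z (0,0)) - ln ?N\<bar>"
    by (simp only: right_diff_distrib[symmetric] abs_mult) simp
  also have "\<dots> \<le> 2/pi * 1" using u l by (intro mult_left_mono) auto
  finally have "\<bar>2/pi * ln (zdist z (0,0)) - 2/pi * ln ?N\<bar> \<le> 2/pi" by simp
  moreover have "\<bar>pot z - 2/pi * ln ?N\<bar> \<le> 32/pi" using pot_asymp_max z unfolding xy by auto
  moreover have "32/pi + 2/pi \<le> 12" using pi_gt3 by (simp add: field_simps)
  ultimately show ?thesis by linarith
qed

section \<open>Walks stopped on leaving a disc\<close>

definition avg4 :: "(pt \<Rightarrow> real) \<Rightarrow> pt \<Rightarrow> real" where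
  "avg4 f y = (f (y + (1,0)) + f (y + (-1,0)) + f (y + (0,1)) + f (y + (0,-1))) / 4"

text \<open>A finite-horizon automaton driven by the walk, general enough to count visits as well as
  time. The state changes by the site being left, so the start is counted and the first site off
  \<open>D\<close> is not.\<close>

primrec run_event :: "pt set \<Rightarrow> (pt \<Rightarrow> 's \<Rightarrow> 's) \<Rightarrow> ('s \<Rightarrow> bool) \<Rightarrow> nat \<Rightarrow> pt \<Rightarrow> 's \<Rightarrow> pt stream \<Rightarrow> bool" where
  "run_event D \<delta> F 0 y s \<omega> = F s"
| "run_event D \<delta> F (Suc T) y s \<omega> = (F s \<or> y \<in> D \<and> run_event D \<delta> F T (y + shd \<omega>) (\<delta> y s) (stl \<omega>))"

primrec run_prob :: "pt set \<Rightarrow> (pt \<Rightarrow> 's \<Rightarrow> 's) \<Rightarrow> ('s \<Rightarrow> bool) \<Rightarrow> nat \<Rightarrow> pt \<Rightarrow> 's \<Rightarrow> real" where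
  "run_prob D \<delta> F 0 y s = of_bool (F s)"
| "run_prob D \<delta> F (Suc T) y s =
    (if F s then 1 else if y \<in> D then avg4 (\<lambda>z. run_prob D \<delta> F T z (\<delta> y s)) y else 0)"

lemma avg4_mono:
  assumes "\<And>e. e \<in> srw_steps \<Longrightarrow> f (y + e) \<le> g (y + e)"
  shows "avg4 f y \<le> avg4 g y"
  unfolding avg4_def using assms by (intro divide_right_mono add_mono) (auto simp: srw_steps_def)

lemma prob_space_srw: "prob_space srw_space"
  unfolding srw_space_def by (rule prob_space.prob_space_stream_space[OF prob_space_measure_pmf])

lemma space_srw [simp]: "space srw_space = UNIV"
  by (simp add: srw_space_def space_stream_space)

lemma run_event_measurable [measurable]: "Measurable.pred srw_space (run_event D \<delta> F T y s)"
proof (induction T arbitrary: y s)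
  case (Suc T)
  have [measurable]: "shd \<in> measurable srw_space (count_space UNIV)" "stl \<in> measurable srw_space srw_space"
    unfolding srw_space_def by measurable
  have [measurable]: "Measurable.pred srw_space (run_event D \<delta> F T z t)" for z t by fact
  \<comment> \<open>The start of the remaining run depends on the first step; the quantifier over
    its countably many values reduces measurability to fixed starts.\<close>
  have "run_event D \<delta> F (Suc T) y s =
    (\<lambda>\<omega>. F s \<or> y \<in> D \<and> (\<exists>e. shd \<omega> = e \<and> run_event D \<delta> F T (y + e) (\<delta> y s) (stl \<omega>)))" by auto
  also have "Measurable.pred srw_space \<dots>" by measurable
  finally show ?case .
next
  case 0
  show ?case unfolding run_event.simps(1)[abs_def] by measurable
qed

text \<open>Turns the law of the walk into the first-step recursion: the first step splits off the
  product measure and the remaining stream has the same law.\<close>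

lemma prob_run_event: "measure srw_space {\<omega>. run_event D \<delta> F T y s \<omega>} = run_prob D \<delta> F T y s"
proof (induction T arbitrary: y s)
  case 0
  interpret prob_space srw_space by (rule prob_space_srw)
  show ?case using prob_space by (simp)
next
  case (Suc T)
  interpret prob_space srw_space by (rule prob_space_srw)
  consider "F s" | "\<not> F s" "y \<notin> D" | "\<not> F s" "y \<in> D" by blast
  then show ?case
  proof cases
    case 3
    let ?E = "\<lambda>e. measure srw_space {\<omega>. run_event D \<delta> F T (y + e) (\<delta> y s) \<omega>}"
    have "ennreal (measure srw_space {\<omega>\<in>space srw_space. run_event D \<delta> F (Suc T) y s \<omega>})
      = (\<integral>\<^sup>+e. measure srw_space {\<omega>\<in>space srw_space. run_event D \<delta> F (Suc T) y s (e ## \<omega>)} \<partial>measure_pmf (pmf_of_set srw_steps))"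
      using run_event_measurable[of D \<delta> F "Suc T" y s, THEN predE]
      unfolding srw_space_def by (rule prob_space.prob_stream_space[OF prob_space_measure_pmf])
    also have "\<dots> = (\<integral>\<^sup>+e. ennreal (?E e) \<partial>measure_pmf (pmf_of_set srw_steps))"
      using 3 by simp
    also have "\<dots> = ennreal (\<Sum>e\<in>srw_steps. ?E e) / 4"
      by (subst nn_integral_pmf_of_set) (auto simp: srw_steps_def sum_ennreal)
    also have "\<dots> = ennreal ((\<Sum>e\<in>srw_steps. ?E e) / 4)"
      by (simp add: divide_ennreal[symmetric] sum_nonneg)
    finally have "measure srw_space {\<omega>. run_event D \<delta> F (Suc T) y s \<omega>} = (\<Sum>e\<in>srw_steps. ?E e) / 4"
      by (simp add: sum_nonneg del: run_event.simps)
    also have "\<dots> = run_prob D \<delta> F (Suc T) y s"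
      unfolding Suc using 3 by (simp add: srw_steps_def avg4_def)
    finally show ?thesis .
  qed (use prob_space in simp_all)
qed

lemma run_event_mono: "run_event D \<delta> F T y s \<omega> \<Longrightarrow> T \<le> T' \<Longrightarrow> run_event D \<delta> F T' y s \<omega>"
proof (induction T arbitrary: T' y s \<omega>)
  case 0 then show ?case by (cases T') auto
next
  case (Suc T)
  then obtain T'' where T': "T' = Suc T''" "T \<le> T''" by (cases T') auto
  show ?case using Suc.prems(1) Suc.IH[OF _ T'(2)] unfolding T' run_event.simps by blast
qed

text \<open>Maximum principle, by induction on the horizon. \<open>E\<close> contains
  \<open>D\<close> and its neighbours: comparison functions built from logarithms have the right
  sign only near the disc.\<close>

lemma run_prob_le:
  assumes W: "\<And>y s. y \<in> E \<Longrightarrow> 0 \<le> W y s" "\<And>y s. y \<in> E \<Longrightarrow> F s \<Longrightarrow> 1 \<le> W y s"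
    and super: "\<And>y s. y \<in> D \<Longrightarrow> \<not> F s \<Longrightarrow> avg4 (\<lambda>z. W z (\<delta> y s)) y \<le> W y s"
    and nb: "\<And>y e. y \<in> D \<Longrightarrow> e \<in> srw_steps \<Longrightarrow> y + e \<in> E"
  shows "y \<in> E \<Longrightarrow> run_prob D \<delta> F T y s \<le> W y s"
proof (induction T arbitrary: y s)
  case (Suc T)
  show ?case
  proof (cases "F s \<or> y \<notin> D")
    case False
    then have "avg4 (\<lambda>z. run_prob D \<delta> F T z (\<delta> y s)) y \<le> avg4 (\<lambda>z. W z (\<delta> y s)) y"
      by (intro avg4_mono Suc.IH nb) auto
    then show ?thesis using super[of y s] False by simp
  qed (use W Suc.prems in auto)
qed (use W in auto)

text \<open>Minimum principle. At horizon 0 the subsolution \<open>u\<close> may be positive while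
  success is pending, so it is reduced by M \<rho>^T \<psi>, which dominates \<open>u\<close> at T =
  0 and, for \<rho> < 1, vanishes as T grows.\<close>

lemma run_prob_ge:
  assumes u: "\<And>y s. y \<in> E \<Longrightarrow> F s \<Longrightarrow> u y s \<le> 1"
    "\<And>y s. y \<in> E \<Longrightarrow> y \<notin> D \<Longrightarrow> \<not> F s \<Longrightarrow> u y s \<le> 0"
    "\<And>y s. y \<in> E \<Longrightarrow> s \<in> S \<Longrightarrow> u y s \<le> M"
    and S: "\<And>y s. s \<in> S \<Longrightarrow> \<delta> y s \<in> S"
    and sub: "\<And>y s. y \<in> D \<Longrightarrow> \<not> F s \<Longrightarrow> u y s \<le> avg4 (\<lambda>z. u z (\<delta> y s)) y"
    and nb: "\<And>y e. y \<in> D \<Longrightarrow> e \<in> srw_steps \<Longrightarrow> y + e \<in> E"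
    and psi: "\<And>y. y \<in> E \<Longrightarrow> 1 \<le> \<psi> y" "\<And>y. y \<in> D \<Longrightarrow> avg4 \<psi> y \<le> \<rho> * \<psi> y"
    and M: "0 \<le> M" "0 \<le> \<rho>"
  shows "y \<in> E \<Longrightarrow> s \<in> S \<Longrightarrow> u y s - M * \<rho> ^ T * \<psi> y \<le> run_prob D \<delta> F T y s"
proof (induction T arbitrary: y s)
  case 0
  have "M * 1 \<le> M * \<psi> y" using psi(1) M 0 by (intro mult_left_mono) auto
  then show ?case using u(1,3)[of y s] 0 M by auto
next
  case (Suc T)
  have pos: "0 \<le> M * \<rho> ^ Suc T * \<psi> y" using M psi(1)[of y] Suc.prems by (intro mult_nonneg_nonneg) auto
  consider "F s" | "\<not> F s" "y \<notin> D" | "\<not> F s" "y \<in> D" by blast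
  then show ?case
  proof cases
    case 3
    have "M * \<rho> ^ T * avg4 \<psi> y \<le> M * \<rho> ^ T * (\<rho> * \<psi> y)"
      using psi(2) M 3 by (intro mult_left_mono) auto
    then have "u y s - M * \<rho> ^ Suc T * \<psi> y \<le> avg4 (\<lambda>z. u z (\<delta> y s)) y - M * \<rho> ^ T * avg4 \<psi> y"
      using sub[of y s] 3 by (simp add: mult_ac)
    also have "\<dots> = avg4 (\<lambda>z. u z (\<delta> y s) - M * \<rho> ^ T * \<psi> z) y"
      by (simp add: avg4_def algebra_simps add_divide_distrib diff_divide_distrib)
    also have "\<dots> \<le> avg4 (\<lambda>z. run_prob D \<delta> F T z (\<delta> y s)) y"
      using Suc.IH Suc.prems nb S 3 by (intro avg4_mono) auto
    finally show ?thesis using 3 by simp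
  qed (use u(1,2)[of y s] pos Suc.prems in auto)
qed

section \<open>Geometric tail of the exit time from a disc\<close>

abbreviation disc :: "nat \<Rightarrow> pt set" where "disc n \<equiv> zdisc (0,0) (real n)"

definition norm2 :: "pt \<Rightarrow> real" where "norm2 z = of_int ((fst z)\<^sup>2 + (snd z)\<^sup>2)"

lemma mem_disc: "z \<in> disc n \<longleftrightarrow> norm2 z \<le> (real n)\<^sup>2"
proof -
  have "zdist (0,0) z = sqrt (norm2 z)" by (simp add: zdist_def norm2_def)
  moreover have "0 \<le> norm2 z" unfolding norm2_def by (simp only: of_int_0_le_iff) simp
  ultimately show ?thesis by (auto simp: zdisc_def real_sqrt_le_iff' sqrt_le_D real_le_lsqrt)
qed

definition disc_nb :: "nat \<Rightarrow> pt set" where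
  "disc_nb n = disc n \<union> {y + e | y e. y \<in> disc n \<and> e \<in> srw_steps}"

lemma norm2_disc_nb: "z \<in> disc_nb n \<Longrightarrow> norm2 z \<le> (real n + 1)\<^sup>2"
proof -
  assume "z \<in> disc_nb n"
  then consider "z \<in> disc n" | y e where "z = y + e" "y \<in> disc n" "e \<in> srw_steps"
    unfolding disc_nb_def by blast
  then show ?thesis
  proof cases
    case 1
    then have "norm2 z \<le> (real n)\<^sup>2" by (simp add: mem_disc)
    also have "\<dots> \<le> (real n + 1)\<^sup>2" by (intro power_mono) auto
    finally show ?thesis .
  next
    case 2
    have y: "norm2 y \<le> (real n)\<^sup>2" using 2 by (simp add: mem_disc)
    have f: "(fst y)\<^sup>2 \<le> (int n)\<^sup>2" "(snd y)\<^sup>2 \<le> (int n)\<^sup>2"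
    proof -
      have "real_of_int ((fst y)\<^sup>2 + (snd y)\<^sup>2) \<le> real_of_int ((int n)\<^sup>2)" using y by (simp add: norm2_def)
      then have "(fst y)\<^sup>2 + (snd y)\<^sup>2 \<le> (int n)\<^sup>2" by (simp only: of_int_le_iff)
      then show "(fst y)\<^sup>2 \<le> (int n)\<^sup>2" "(snd y)\<^sup>2 \<le> (int n)\<^sup>2"
        using zero_le_power2[of "fst y"] zero_le_power2[of "snd y"] by linarith+
    qed
    then have f': "\<bar>fst y\<bar> \<le> int n" "\<bar>snd y\<bar> \<le> int n"
      by (auto simp: abs_le_square_iff[symmetric])
    then have f'': "\<bar>real_of_int (fst y)\<bar> \<le> real n" "\<bar>real_of_int (snd y)\<bar> \<le> real n" by linarith+
    have "norm2 z \<le> norm2 y + 2 * real n + 1"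
      using 2(1,3) f'' by (auto simp: norm2_def srw_steps_def power2_eq_square algebra_simps abs_le_iff)
    also have "\<dots> \<le> (real n + 1)\<^sup>2" using y by (simp add: power2_eq_square algebra_simps)
    finally show ?thesis .
  qed
qed

lemma disc_nb_step: "y \<in> disc n \<Longrightarrow> e \<in> srw_steps \<Longrightarrow> y + e \<in> disc_nb n"
  unfolding disc_nb_def by blast

lemma finite_norm2_le: "finite {z. norm2 z \<le> c}"
proof (rule finite_subset)
  let ?m = "\<lceil>\<bar>c\<bar>\<rceil>"
  show "{z. norm2 z \<le> c} \<subseteq> {-?m..?m} \<times> {-?m..?m}"
  proof
    fix z assume "z \<in> {z. norm2 z \<le> c}"
    then have "real_of_int ((fst z)\<^sup>2 + (snd z)\<^sup>2) \<le> \<bar>c\<bar>" by (simp add: norm2_def)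
    then have "(fst z)\<^sup>2 + (snd z)\<^sup>2 \<le> ?m" by linarith
    moreover have "\<bar>fst z\<bar> \<le> (fst z)\<^sup>2" "\<bar>snd z\<bar> \<le> (snd z)\<^sup>2"
      using self_le_power[of "\<bar>fst z\<bar>" 2] self_le_power[of "\<bar>snd z\<bar>" 2] by (cases "fst z = 0"; cases "snd z = 0"; force)+
    moreover have "0 \<le> (fst z)\<^sup>2" "0 \<le> (snd z)\<^sup>2" by auto
    ultimately have "\<bar>fst z\<bar> \<le> ?m" "\<bar>snd z\<bar> \<le> ?m" by linarith+
    then show "z \<in> {-?m..?m} \<times> {-?m..?m}" by (cases z) (auto simp: abs_le_iff)
  qed
qed simp

lemma finite_disc: "finite (disc n)"
  using finite_norm2_le[of "(real n)\<^sup>2"] by (simp add: mem_disc[abs_def, symmetric] flip: Collect_mem_eq) 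

lemma finite_disc_nb: "finite (disc_nb n)"
  by (rule finite_subset[OF _ finite_norm2_le[of "(real n + 1)\<^sup>2"]]) (auto simp: norm2_disc_nb)

text \<open>The squared norm grows by 1 per step on average, so this function drops by 1. On
  \<open>disc_nb n\<close> it lies between 1 and (n + 1)^2 + 1, hence the drop is a contraction by
  \<open>exit_rate n\<close>.\<close>

definition exit_fun :: "nat \<Rightarrow> pt \<Rightarrow> real" where
  "exit_fun n z = (real n + 1)\<^sup>2 + 1 - norm2 z"

definition exit_rate :: "nat \<Rightarrow> real" where
  "exit_rate n = 1 - 1 / ((real n + 1)\<^sup>2 + 1)"

lemma exit_rate: "0 \<le> exit_rate n" "exit_rate n < 1"
proof -
  have "1 / ((real n + 1)\<^sup>2 + 1) \<le> 1" by (simp add: divide_le_eq_1 add_nonneg_pos)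
  moreover have "0 < 1 / ((real n + 1)\<^sup>2 + 1)" by (intro divide_pos_pos add_nonneg_pos) auto
  ultimately show "0 \<le> exit_rate n" "exit_rate n < 1" unfolding exit_rate_def by linarith+
qed

lemma exit_fun_ge: "z \<in> disc_nb n \<Longrightarrow> 1 \<le> exit_fun n z"
  using norm2_disc_nb[of z n] by (simp add: exit_fun_def)

lemma avg4_exit_fun: "avg4 (exit_fun n) z \<le> exit_rate n * exit_fun n z"
proof -
  let ?R = "(real n + 1)\<^sup>2 + 1"
  have R: "0 < ?R" by (intro add_nonneg_pos) auto
  have "0 \<le> norm2 z" unfolding norm2_def by (simp only: of_int_0_le_iff) simp
  then have "exit_fun n z \<le> ?R" by (simp add: exit_fun_def)
  then have "exit_fun n z / ?R \<le> 1" using R by (simp add: divide_le_eq_1)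
  moreover have "avg4 (exit_fun n) z = exit_fun n z - 1"
    by (simp add: avg4_def exit_fun_def norm2_def power2_eq_square field_simps)
  ultimately show ?thesis by (simp add: exit_rate_def left_diff_distrib)
qed

section \<open>Visits before the exit time\<close>

lemma AE_steps: "AE \<omega> in srw_space. \<forall>i. \<omega> !! i \<in> srw_steps"
proof -
  have "AE x in measure_pmf (pmf_of_set srw_steps). x \<in> srw_steps"
    by (simp add: AE_measure_pmf_iff srw_steps_def)
  then have "AE \<omega> in srw_space. stream_all (\<lambda>x. x \<in> srw_steps) \<omega>"
    unfolding srw_space_def by (rule prob_space.AE_stream_all[OF prob_space_measure_pmf, rotated]) auto
  then show ?thesis by eventually_elim (use snth_sset in blast)
qed

lemma add_origin [simp]: "(0,0) + z = z" "z + (0,0) = (z :: pt)"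
  by (simp_all add: prod_eq_iff)

lemma walk_0: "walk \<omega> 0 = (0,0)"
  by (simp add: walk_def)

lemma walk_Suc: "walk \<omega> (Suc m) = walk \<omega> m + \<omega> !! m"
  by (simp add: walk_def prod_eq_iff)

lemma walk_Suc_shd: "walk \<omega> (Suc m) = shd \<omega> + walk (stl \<omega>) m"
  by (simp add: walk_def prod_eq_iff sum.lessThan_Suc_shift del: sum.lessThan_Suc)

text \<open>A countdown at every step makes success mean survival in \<open>D\<close>, which brings
  the exit time under the same maximum principle.\<close>

lemma run_event_stay:
  "run_event D (\<lambda>_ c. c - Suc 0) (\<lambda>c. c = 0) T y c \<omega> \<longleftrightarrow> c \<le> T \<and> (\<forall>l<c. y + walk \<omega> l \<in> D)"
proof (induction T arbitrary: y c \<omega>)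
  case (Suc T)
  note IH = Suc.IH
  show ?case
  proof (cases c)
    case (Suc c')
    have "(\<forall>l<Suc c'. y + walk \<omega> l \<in> D) \<longleftrightarrow> y \<in> D \<and> (\<forall>l<c'. y + shd \<omega> + walk (stl \<omega>) l \<in> D)"
      unfolding All_less_Suc2 walk_Suc_shd walk_0 by (simp add: add.assoc)
    then show ?thesis using Suc by (auto simp: IH)
  qed simp
qed auto

text \<open>The state records the visits still missing; truncated subtraction makes surplus visits
  harmless.\<close>

definition count_dec :: "pt \<Rightarrow> pt \<Rightarrow> pt \<Rightarrow> nat \<times> nat \<Rightarrow> nat \<times> nat" where
  "count_dec a b y s = (fst s - of_bool (y = a), snd s - of_bool (y = b))"

lemma run_event_count:
  "run_event D (count_dec a b) (\<lambda>s. s = (0,0)) T y (i,j) \<omega> \<longleftrightarrow>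
    (\<exists>m\<le>T. (\<forall>l<m. y + walk \<omega> l \<in> D) \<and> i \<le> (\<Sum>l<m. of_bool (y + walk \<omega> l = a))
      \<and> j \<le> (\<Sum>l<m. of_bool (y + walk \<omega> l = b)))"
proof (induction T arbitrary: y i j \<omega>)
  case (Suc T)
  have split: "(\<exists>m\<le>Suc T. P m) \<longleftrightarrow> P 0 \<or> (\<exists>m\<le>T. P (Suc m))" for P :: "nat \<Rightarrow> bool"
    by (metis Suc_le_mono not0_implies_Suc zero_le)
  have step: "(\<forall>l<Suc m. y + walk \<omega> l \<in> D) \<longleftrightarrow> y \<in> D \<and> (\<forall>l<m. y + shd \<omega> + walk (stl \<omega>) l \<in> D)"
    "(\<Sum>l<Suc m. of_bool (y + walk \<omega> l = c)) = of_bool (y = c) + (\<Sum>l<m. of_bool (y + shd \<omega> + walk (stl \<omega>) l = c) :: nat)" for m c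
    unfolding All_less_Suc2 sum.lessThan_Suc_shift walk_Suc_shd walk_0
    by (simp_all add: add.assoc del: sum_of_bool_eq)
  have cd: "count_dec a b y (i,j) = (i - of_bool (y = a), j - of_bool (y = b))"
    by (simp add: count_dec_def)
  show ?case
    unfolding split step run_event.simps cd Suc.IH le_diff_conv
    by (simp add: add.commute del: sum_of_bool_eq) blast
qed auto

lemma visits_eq_sum: "visits \<omega> m x = (\<Sum>l\<le>m. of_bool (walk \<omega> l = x))"
proof -
  have "(\<Sum>l\<le>m. of_bool (walk \<omega> l = x) :: nat) = card ({..m} \<inter> {l. walk \<omega> l = x})"
    by (subst sum_of_bool_eq) auto
  also have "{..m} \<inter> {l. walk \<omega> l = x} = {i. i \<le> m \<and> walk \<omega> i = x}" by auto
  finally show ?thesis by (simp add: visits_def)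
qed

lemma walk_measurable [measurable]: "(\<lambda>\<omega>. walk \<omega> m) \<in> measurable srw_space (count_space UNIV)"
proof (induction m)
  case 0 then show ?case by (simp add: walk_0)
next
  case (Suc m)
  note [measurable] = Suc
  have [measurable]: "(\<lambda>\<omega>. \<omega> !! m) \<in> measurable srw_space (count_space UNIV)"
    unfolding srw_space_def by measurable
  show ?case unfolding walk_Suc by measurable
qed

lemma hit_time_measurable [measurable]: "hit_time n \<in> measurable srw_space (count_space UNIV)"
  unfolding hit_time_def[abs_def] by measurable

lemma visits_measurable [measurable]:
  "(\<lambda>\<omega>. visits \<omega> (hit_time n \<omega>) x) \<in> measurable srw_space (count_space UNIV)"
proof -
  have "(\<lambda>\<omega>. visits \<omega> (hit_time n \<omega>) x) = (\<lambda>\<omega>. card {i. i \<le> hit_time n \<omega> \<and> walk \<omega> i = x})"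
    by (simp add: visits_def)
  also have "\<dots> \<in> measurable srw_space (count_space UNIV)" by measurable
  finally show ?thesis .
qed

lemma zbd_disc_nb: "z \<in> zbd (disc n) \<Longrightarrow> z \<notin> disc n" by (simp add: zbd_def)

lemma step_leaves_through_zbd: "y \<in> D \<Longrightarrow> e \<in> srw_steps \<Longrightarrow> y + e \<notin> D \<Longrightarrow> y + e \<in> zbd D"
  by (auto simp: zbd_def zdist_def srw_steps_def intro!: bexI[of _ y])

lemma zero_in_disc: "(0,0) \<in> disc n"
  by (simp add: mem_disc norm2_def)

text \<open>Comparison with \<open>exit_rate n ^ c * exit_fun n\<close> makes survival for
  \<open>c\<close> steps geometrically unlikely.\<close>

lemma AE_leaves: "AE \<omega> in srw_space. \<exists>l. walk \<omega> l \<notin> disc n"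
proof -
  interpret prob_space srw_space by (rule prob_space_srw)
  let ?S = "\<lambda>c. {\<omega>. \<forall>l<c. walk \<omega> l \<in> disc n}"
  have S: "?S c = {\<omega>. run_event (disc n) (\<lambda>_ c. c - Suc 0) (\<lambda>c. c = 0) c (0,0) c \<omega>}" for c
    by (simp add: run_event_stay)
  have m: "?S c \<in> sets srw_space" for c
    using run_event_measurable[of "disc n" "\<lambda>_ c. c - Suc 0" "\<lambda>c. c = 0" c "(0,0)" c, THEN predE] by (simp add: S)
  have "prob (?S c) \<le> exit_rate n ^ c * exit_fun n (0,0)" for c
    unfolding S prob_run_event
  proof (rule run_prob_le[where E = "disc_nb n" and W = "\<lambda>y c. exit_rate n ^ c * exit_fun n y"])
    fix y :: pt and s :: nat
    show "y \<in> disc_nb n \<Longrightarrow> 0 \<le> exit_rate n ^ s * exit_fun n y"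
      using exit_fun_ge[of y n] exit_rate(1)[of n] by simp
    show "y \<in> disc_nb n \<Longrightarrow> s = 0 \<Longrightarrow> 1 \<le> exit_rate n ^ s * exit_fun n y"
      using exit_fun_ge[of y n] by simp
    show "avg4 (\<lambda>z. exit_rate n ^ (s - Suc 0) * exit_fun n z) y \<le> exit_rate n ^ s * exit_fun n y" if "s \<noteq> 0"
    proof -
      have "avg4 (\<lambda>z. exit_rate n ^ (s - Suc 0) * exit_fun n z) y = exit_rate n ^ (s - Suc 0) * avg4 (exit_fun n) y"
        by (simp add: avg4_def algebra_simps)
      also have "\<dots> \<le> exit_rate n ^ (s - Suc 0) * (exit_rate n * exit_fun n y)"
        using exit_rate(1)[of n] by (intro mult_left_mono avg4_exit_fun) auto
      also have "\<dots> = exit_rate n ^ s * exit_fun n y" using that by (cases s) auto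
      finally show ?thesis .
    qed
  qed (use disc_nb_step zero_in_disc in \<open>auto simp: disc_nb_def\<close>)
  moreover have "(\<lambda>c. exit_rate n ^ c * exit_fun n (0,0)) \<longlonglongrightarrow> 0"
    using exit_rate[of n] by (intro tendsto_mult_left_zero LIMSEQ_power_zero) auto
  ultimately have lim: "(\<lambda>c. prob (?S c)) \<longlonglongrightarrow> 0"
    by (rule_tac tendsto_sandwich[OF _ _ tendsto_const]) (auto intro!: always_eventually)
  let ?N = "{\<omega>. \<forall>l. walk \<omega> l \<in> disc n}"
  have N: "?N \<in> sets srw_space"
  proof -
    have "?N = (\<Inter>c. ?S c)" by auto
    also have "\<dots> \<in> sets srw_space" using m by (intro sets.countable_INT) auto
    finally show ?thesis .
  qed
  have "prob ?N \<le> prob (?S c)" for c using m by (intro finite_measure_mono) auto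
  then have "prob ?N \<le> 0" by (intro LIMSEQ_le_const[OF lim]) auto
  then have "prob ?N = 0" using measure_nonneg[of srw_space ?N] by linarith
  then have "AE \<omega> in srw_space. \<omega> \<notin> ?N" using N by (subst (asm) prob_eq_0) auto
  then show ?thesis by eventually_elim auto
qed

text \<open>\<open>hit_time\<close> waits for \<open>zbd\<close>, whereas \<open>run_event\<close>
  stops at the first site off the disc; they agree because unit steps leave the disc only through
  \<open>zbd\<close>. The null set excludes streams with other steps and streams that never leave,
  for which \<open>LEAST\<close> is unspecified.\<close>

lemma AE_hit_time:
  "AE \<omega> in srw_space. walk \<omega> (hit_time n \<omega>) \<notin> disc n \<and> (\<forall>l<hit_time n \<omega>. walk \<omega> l \<in> disc n)"
  using AE_steps AE_leaves[of n]
proof eventually_elim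
  case (elim \<omega>)
  define t where "t = (LEAST l. walk \<omega> l \<notin> disc n)"
  have t: "walk \<omega> t \<notin> disc n" unfolding t_def using elim(2) by (rule LeastI_ex)
  have before: "walk \<omega> l \<in> disc n" if "l < t" for l using that not_less_Least unfolding t_def by blast
  have "t \<noteq> 0" using t zero_in_disc by (auto simp: walk_0 intro: gr0I)
  then obtain t' where t': "t = Suc t'" by (cases t) auto
  have "walk \<omega> t \<in> zbd (disc n)"
    unfolding t' walk_Suc
    by (rule step_leaves_through_zbd) (use before[of t'] elim(1) t in \<open>auto simp: t' walk_Suc\<close>)
  moreover have "walk \<omega> l \<notin> zbd (disc n)" if "l < t" for l using before[OF that] zbd_disc_nb by blast
  ultimately have "hit_time n \<omega> = t"
    unfolding hit_time_def by (intro Least_equality) (auto simp: not_less[symmetric])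
  then show ?case using t before by simp
qed

definition pair_prob :: "nat \<Rightarrow> nat \<Rightarrow> pt \<Rightarrow> pt \<Rightarrow> real" where
  "pair_prob n k a b = measure srw_space
    {\<omega>. k \<le> visits \<omega> (hit_time n \<omega>) a \<and> k \<le> visits \<omega> (hit_time n \<omega>) b}"

abbreviation count_prob :: "nat \<Rightarrow> pt \<Rightarrow> pt \<Rightarrow> nat \<Rightarrow> pt \<Rightarrow> nat \<times> nat \<Rightarrow> real" where
  "count_prob n a b \<equiv> run_prob (disc n) (count_dec a b) (\<lambda>s. s = (0,0))"

lemma AE_visits_iff:
  assumes ab: "a \<in> disc n" "b \<in> disc n"
  shows "AE \<omega> in srw_space. (k \<le> visits \<omega> (hit_time n \<omega>) a \<and> k \<le> visits \<omega> (hit_time n \<omega>) b)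
    = (\<exists>T. run_event (disc n) (count_dec a b) (\<lambda>s. s = (0,0)) T (0,0) (k,k) \<omega>)"
  using AE_hit_time[of n]
proof eventually_elim
  case (elim \<omega>)
  let ?t = "hit_time n \<omega>"
  \<comment> \<open>At time \<open>?t\<close> the walk is off the disc, so the inclusive count of
    \<open>visits\<close> and the strict count of \<open>run_event\<close> agree.\<close>
  have v: "visits \<omega> ?t c = (\<Sum>l<?t. of_bool (walk \<omega> l = c))" if "c \<in> disc n" for c
  proof -
    have "walk \<omega> ?t \<noteq> c" using elim that by auto
    then show ?thesis unfolding visits_eq_sum by (simp flip: lessThan_Suc_atMost)
  qed
  have mono: "(\<Sum>l<m. of_bool (walk \<omega> l = c)) \<le> (\<Sum>l<?t. of_bool (walk \<omega> l = c) :: nat)" if "\<forall>l<m. walk \<omega> l \<in> disc n" for m c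
  proof -
    have "m \<le> ?t" using that elim by (meson not_less)
    then show ?thesis by (intro sum_mono2) auto
  qed
  show ?case
    unfolding run_event_count v[OF ab(1)] v[OF ab(2)] add_origin
    using elim mono by (meson le_trans order_refl)
qed

text \<open>Up to a null set the events of horizon \<open>T\<close> increase to the visit event:
  each horizon bounds it from below, and an upper bound uniform in \<open>T\<close> survives the
  limit.\<close>

lemma pair_prob_bounds:
  assumes ab: "a \<in> disc n" "b \<in> disc n"
  shows "count_prob n a b T (0,0) (k,k) \<le> pair_prob n k a b"
    and "(\<And>T. count_prob n a b T (0,0) (k,k) \<le> B) \<Longrightarrow> pair_prob n k a b \<le> B"
proof -
  interpret prob_space srw_space by (rule prob_space_srw)
  let ?R = "\<lambda>T. {\<omega>. run_event (disc n) (count_dec a b) (\<lambda>s. s = (0,0)) T (0,0) (k,k) \<omega>}"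
  let ?J = "{\<omega>. k \<le> visits \<omega> (hit_time n \<omega>) a \<and> k \<le> visits \<omega> (hit_time n \<omega>) b}"
  have R: "?R T \<in> events" for T
    using run_event_measurable[of "disc n" "count_dec a b" "\<lambda>s. s = (0,0)" T "(0,0)" "(k,k)", THEN predE] by simp
  have J: "?J \<in> events"
  proof -
    have "{\<omega>\<in>space srw_space. k \<le> visits \<omega> (hit_time n \<omega>) a \<and> k \<le> visits \<omega> (hit_time n \<omega>) b} \<in> events" by measurable
    then show ?thesis by simp
  qed
  have U: "(\<Union>T. ?R T) \<in> events" using R by blast
  have eq: "prob ?J = prob (\<Union>T. ?R T)"
    by (rule finite_measure_eq_AE) (use AE_visits_iff[OF ab, of k] J U in auto)
  have RP: "prob (?R T) = count_prob n a b T (0,0) (k,k)" for T by (rule prob_run_event)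
  show "count_prob n a b T (0,0) (k,k) \<le> pair_prob n k a b"
    unfolding pair_prob_def eq RP[symmetric] using U by (intro finite_measure_mono) auto
  assume B: "\<And>T. count_prob n a b T (0,0) (k,k) \<le> B"
  have "(\<lambda>T. prob (?R T)) \<longlonglongrightarrow> prob (\<Union>T. ?R T)"
    using R by (intro finite_Lim_measure_incseq) (auto simp: incseq_def intro: run_event_mono)
  then have "prob (\<Union>T. ?R T) \<le> B" by (rule LIMSEQ_le_const2) (use B RP in auto)
  then show "pair_prob n k a b \<le> B" unfolding pair_prob_def eq .
qed

text \<open>Linearity of expectation over ordered pairs. The diagonal belongs to the sum; the
  one-point bound will handle it.\<close>

lemma integral_close_pairs:
  "integral\<^sup>L srw_space (\<lambda>\<omega>. real (close_pairs n \<alpha> \<beta> \<omega>)) =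
    (\<Sum>p\<in>{p. fst p \<in> disc n \<and> snd p \<in> disc n \<and> zdist (fst p) (snd p) \<le> real n powr \<beta>}.
      pair_prob n (nat \<lceil>4 * \<alpha> / pi * (ln (real n))\<^sup>2\<rceil>) (fst p) (snd p))"
proof -
  interpret prob_space srw_space by (rule prob_space_srw)
  define k where "k = nat \<lceil>4 * \<alpha> / pi * (ln (real n))\<^sup>2\<rceil>"
  define Q where "Q = {p. fst p \<in> disc n \<and> snd p \<in> disc n \<and> zdist (fst p) (snd p) \<le> real n powr \<beta>}"
  define J where "J p = {\<omega>. k \<le> visits \<omega> (hit_time n \<omega>) (fst p) \<and> k \<le> visits \<omega> (hit_time n \<omega>) (snd p)}" for p
  have Q: "finite Q" by (rule finite_subset[of _ "disc n \<times> disc n"]) (auto simp: finite_disc Q_def)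
  have J: "J p \<in> events" for p
  proof -
    have "{\<omega>\<in>space srw_space. k \<le> visits \<omega> (hit_time n \<omega>) (fst p) \<and> k \<le> visits \<omega> (hit_time n \<omega>) (snd p)} \<in> events" by measurable
    then show ?thesis by (simp add: J_def)
  qed
  have "real (close_pairs n \<alpha> \<beta> \<omega>) = (\<Sum>p\<in>Q. indicator (J p) \<omega>)" for \<omega>
  proof -
    have "{(a,b). a \<in> Psi n \<alpha> \<omega> \<and> b \<in> Psi n \<alpha> \<omega> \<and> zdist a b \<le> real n powr \<beta>} = {p \<in> Q. \<omega> \<in> J p}"
      by (auto simp: Psi_def Q_def J_def k_def nat_le_iff)
    then have "close_pairs n \<alpha> \<beta> \<omega> = card (Q \<inter> {p. \<omega> \<in> J p})"
      by (simp add: close_pairs_def Collect_conj_eq)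
    also have "real \<dots> = (\<Sum>p\<in>Q. of_bool (\<omega> \<in> J p))"
      using Q by (simp add: sum_of_bool_eq)
    finally show ?thesis by (simp add: indicator_def of_bool_def)
  qed
  then have "integral\<^sup>L srw_space (\<lambda>\<omega>. real (close_pairs n \<alpha> \<beta> \<omega>)) = (\<Sum>p\<in>Q. integral\<^sup>L srw_space (indicator (J p)))"
    using J by (simp add: Bochner_Integration.integral_sum emeasure_eq_measure)
  also have "\<dots> = (\<Sum>p\<in>Q. prob (J p))" by simp
  finally show ?thesis by (simp add: pair_prob_def Q_def J_def k_def)
qed

section \<open>Two-point visit probabilities\<close>

lemma avg4_pot: "avg4 (\<lambda>z. pot (z - a)) y = pot (y - a) + of_bool (y = a)"
proof -
  obtain x1 x2 a1 a2 where [simp]: "y = (x1,x2)" "a = (a1,a2)" by (cases y, cases a) auto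
  show ?thesis using pot_laplace[of "x1 - a1" "x2 - a2"]
    by (simp add: avg4_def algebra_simps)
qed

lemma pot_minus_commute: "pot (a - b) = pot (b - a)"
proof -
  obtain x1 x2 a1 a2 where [simp]: "b = (x1,x2)" "a = (a1,a2)" by (cases b, cases a) auto
  show ?thesis using pot_uminus[of "a1 - x1" "a2 - x2"] by simp
qed

lemma avg4_lincomb: "avg4 (\<lambda>z. c0 + c1 * f z + c2 * g z) y = c0 + c1 * avg4 f y + c2 * avg4 g y"
  by (simp add: avg4_def field_simps)

lemma avg4_cmult: "avg4 (\<lambda>z. f z * c) y = avg4 f y * c"
  by (simp add: avg4_def algebra_simps)

text \<open>Exponential Chebyshev: \<open>w\<close> bounds the moment \<open>E ((1 + 1/g) ^ N)\<close> of the number \<open>N\<close> of visits to \<open>P\<close>.\<close>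

lemma run_prob_count_le:
  fixes w :: "pt \<Rightarrow> real" and \<theta> :: "nat \<times> nat \<Rightarrow> nat"
  assumes w: "\<And>y. y \<in> disc_nb n \<Longrightarrow> 1 \<le> w y" and wP: "\<And>y. y \<in> P \<Longrightarrow> w y = 1 + g"
    and avg: "\<And>y. y \<in> disc n \<Longrightarrow> avg4 w y = w y - of_bool (y \<in> P)"
    and \<theta>: "\<theta> (0,0) = 0" "\<And>y s. \<theta> s \<le> \<theta> (count_dec a b y s) + of_bool (y \<in> P)"
    and g: "0 < g"
  shows "count_prob n a b T (0,0) s \<le> w (0,0) * exp (- real (\<theta> s) / (1 + g))"
proof -
  \<comment> \<open>Averaging at a site of \<open>P\<close> turns w = 1 + g into g; this ratio
    exactly cancels the factor 1/c gained when one visit is used up.\<close>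
  define c where "c = g / (1 + g)"
  have c: "0 < c" "c \<le> 1" using g by (auto simp: c_def)
  have "count_prob n a b T (0,0) s \<le> w (0,0) * c ^ \<theta> s"
  proof (rule run_prob_le[where E = "disc_nb n" and W = "\<lambda>y s. w y * c ^ \<theta> s"])
    fix y s
    show "y \<in> disc_nb n \<Longrightarrow> 0 \<le> w y * c ^ \<theta> s" using w[of y] c by simp
    show "y \<in> disc_nb n \<Longrightarrow> s = (0,0) \<Longrightarrow> 1 \<le> w y * c ^ \<theta> s" using w[of y] \<theta>(1) by simp
    assume y: "y \<in> disc n"
    let ?s = "count_dec a b y s"
    have wy: "1 \<le> w y" using y w[of y] by (simp add: disc_nb_def)
    have "avg4 (\<lambda>z. w z * c ^ \<theta> ?s) y = (w y - of_bool (y \<in> P)) * c ^ \<theta> ?s"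
      using avg[OF y] by (simp add: avg4_cmult)
    also have "\<dots> \<le> w y * c ^ \<theta> s"
    proof (cases "y \<in> P")
      case True
      have "(w y - of_bool (y \<in> P)) * c ^ \<theta> ?s = (1 + g) * c ^ (\<theta> ?s + 1)"
        using True wP g by (simp add: c_def)
      also have "\<dots> \<le> (1 + g) * c ^ \<theta> s"
        using \<theta>(2)[of s y] True c g by (intro mult_left_mono power_decreasing) auto
      finally show ?thesis using wP True by simp
    next
      case False
      then show ?thesis using \<theta>(2)[of s y] c wy by (simp add: power_decreasing)
    qed
    finally show "avg4 (\<lambda>z. w z * c ^ \<theta> ?s) y \<le> w y * c ^ \<theta> s" .
  qed (use disc_nb_step zero_in_disc in \<open>auto simp: disc_nb_def\<close>)
  also have "\<dots> \<le> w (0,0) * exp (- real (\<theta> s) / (1 + g))"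
  proof (rule mult_left_mono)
    have "c = 1 + (- 1 / (1 + g))" using g by (simp add: c_def field_simps)
    also have "\<dots> \<le> exp (- 1 / (1 + g))" by (rule exp_ge_add_one_self)
    finally have "c ^ \<theta> s \<le> exp (- 1 / (1 + g)) ^ \<theta> s" using c by (intro power_mono) auto
    also have "\<dots> = exp (- real (\<theta> s) / (1 + g))" by (simp add: exp_of_nat_mult[symmetric])
    finally show "c ^ \<theta> s \<le> exp (- real (\<theta> s) / (1 + g))" .
    show "0 \<le> w (0,0)" using w[of "(0,0)"] zero_in_disc[of n] by (simp add: disc_nb_def)
  qed
  finally show ?thesis .
qed

text \<open>Only the total number 2 k of visits to the pair is used. The function w = 1 + 2 A - pot
  (y - a) - pot (y - b) has the same value at \<open>a\<close> and \<open>b\<close>, so every visit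
  costs the same factor, and g = 2 A - pot (a - b) plays the role of the diagonal plus the
  off-diagonal Green function.\<close>

lemma pair_prob_le_two_point:
  assumes ab: "a \<in> disc n" "b \<in> disc n" "a \<noteq> b"
    and A: "\<And>z. z \<in> disc_nb n \<Longrightarrow> pot (z - a) \<le> A" "\<And>z. z \<in> disc_nb n \<Longrightarrow> pot (z - b) \<le> A"
    and g: "0 < 2 * A - pot (a - b)"
  shows "pair_prob n k a b \<le> (1 + 2 * A) * exp (- (2 * real k) / (1 + 2 * A - pot (a - b)))"
proof -
  define w where "w y = (1 + 2 * A) + (-1) * pot (y - a) + (-1) * pot (y - b)" for y
  let ?\<theta> = "\<lambda>s::nat \<times> nat. fst s + snd s"
  have p0: "pot (a - a) = 0" for a using pot_0 by (simp add: zero_prod_def)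
  show ?thesis
  proof (rule pair_prob_bounds(2)[OF ab(1,2)])
    fix T
    have "count_prob n a b T (0,0) (k,k) \<le> w (0,0) * exp (- real (?\<theta> (k,k)) / (1 + (2 * A - pot (a - b))))"
    proof (rule run_prob_count_le[where P = "{a,b}"])
      show "1 \<le> w y" if "y \<in> disc_nb n" for y using A[OF that] by (simp add: w_def)
      show "w y = 1 + (2 * A - pot (a - b))" if "y \<in> {a,b}" for y
        using that p0 pot_minus_commute[of a b] by (auto simp: w_def)
      show "avg4 w y = w y - of_bool (y \<in> {a,b})" for y
        unfolding w_def[abs_def] avg4_lincomb avg4_pot using ab(3) by simp
      show "?\<theta> s \<le> ?\<theta> (count_dec a b y s) + of_bool (y \<in> {a, b})" for y s
        using ab(3) by (auto simp: count_dec_def)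
    qed (use g in auto)
    also have "\<dots> \<le> (1 + 2 * A) * exp (- real (?\<theta> (k,k)) / (1 + (2 * A - pot (a - b))))"
      using pot_nonneg[of "(0,0) - a"] pot_nonneg[of "(0,0) - b"] by (intro mult_right_mono) (auto simp: w_def)
    also have "\<dots> = (1 + 2 * A) * exp (- (2 * real k) / (1 + 2 * A - pot (a - b)))"
      by (simp add: algebra_simps)
    finally show "count_prob n a b T (0,0) (k,k) \<le> \<dots>" .
  qed
qed

lemma pair_prob_le_one_point:
  assumes ab: "a \<in> disc n" "b \<in> disc n"
    and A: "\<And>z. z \<in> disc_nb n \<Longrightarrow> pot (z - a) \<le> A" "0 < A"
  shows "pair_prob n k a b \<le> (1 + A) * exp (- real k / (1 + A))"
proof -
  define w where "w y = (1 + A) + (-1) * pot (y - a) + 0 * pot (y - a)" for y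
  have p0: "pot (a - a) = 0" for a using pot_0 by (simp add: zero_prod_def)
  show ?thesis
  proof (rule pair_prob_bounds(2)[OF ab(1,2)])
    fix T
    have "count_prob n a b T (0,0) (k,k) \<le> w (0,0) * exp (- real (fst (k,k)) / (1 + A))"
    proof (rule run_prob_count_le[where P = "{a}"])
      show "1 \<le> w y" if "y \<in> disc_nb n" for y using A(1)[OF that] by (simp add: w_def)
      show "w y = 1 + A" if "y \<in> {a}" for y using that p0 by (auto simp: w_def)
      show "avg4 w y = w y - of_bool (y \<in> {a})" for y
        unfolding w_def[abs_def] avg4_lincomb avg4_pot by simp
      show "fst s \<le> fst (count_dec a b y s) + of_bool (y \<in> {a})" for y s
        by (auto simp: count_dec_def)
    qed (use A in auto)
    also have "\<dots> \<le> (1 + A) * exp (- real k / (1 + A))"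
      using pot_nonneg[of "(0,0) - a"] by (simp add: w_def)
    finally show "count_prob n a b T (0,0) (k,k) \<le> \<dots>" .
  qed
qed

text \<open>Weight of \<open>m\<close> departures from one point, of which \<open>R\<close> cross to
  the other point (weight \<open>q\<close>) and the others return (weight \<open>p\<close>).\<close>

definition binom_term :: "real \<Rightarrow> real \<Rightarrow> nat \<Rightarrow> nat \<Rightarrow> real" where
  "binom_term p q m R = real (m choose R) * q ^ R * p ^ (m - R)"

lemma binom_term_Suc_Suc:
  "binom_term p q (Suc m) (Suc R) = p * binom_term p q m (Suc R) + q * binom_term p q m R"
proof (cases "Suc R \<le> m")
  case True
  then have "p ^ (m - R) = p * p ^ (m - Suc R)" by (metis Suc_diff_Suc Suc_le_lessD power_Suc)
  then show ?thesis by (simp add: binom_term_def algebra_simps)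
qed (simp add: binom_term_def not_le binomial_eq_0)

lemma binom_term_0 [simp]: "binom_term p q m 0 = p ^ m"
  by (simp add: binom_term_def)

lemma binom_term_eq_0: "m < R \<Longrightarrow> binom_term p q m R = 0"
  by (simp add: binom_term_def binomial_eq_0)

lemma binom_term_nonneg: "0 \<le> p \<Longrightarrow> 0 \<le> q \<Longrightarrow> 0 \<le> binom_term p q m R"
  by (simp add: binom_term_def)

text \<open>The generating sums over the number \<open>R\<close> of crossings between the two points: \<open>m\<close> further
  visits at the first point and \<open>l\<close> at the second one, the walk being at the first (\<open>from_a\<close>) or at
  the second (\<open>from_b\<close>) point.\<close>

definition from_a :: "real \<Rightarrow> real \<Rightarrow> nat \<Rightarrow> nat \<Rightarrow> real" where
  "from_a p q m l = (\<Sum>R\<le>m. binom_term p q m R * binom_term p q l R)"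

definition from_b :: "real \<Rightarrow> real \<Rightarrow> nat \<Rightarrow> nat \<Rightarrow> real" where
  "from_b p q m l = (\<Sum>R\<le>m. binom_term p q m R * binom_term p q l (Suc R))"

lemma from_a_Suc: "from_a p q (Suc m) l = p * from_a p q m l + q * from_b p q m l"
proof -
  let ?t = "binom_term p q"
  have "from_a p q (Suc m) l = p ^ Suc m * p ^ l + (\<Sum>R\<le>m. ?t (Suc m) (Suc R) * ?t l (Suc R))"
    unfolding from_a_def by (subst sum.atMost_Suc_shift) simp
  also have "\<dots> = p * (p ^ m * p ^ l + (\<Sum>R\<le>m. ?t m (Suc R) * ?t l (Suc R))) + q * from_b p q m l"
    by (simp add: binom_term_Suc_Suc from_b_def algebra_simps sum.distrib sum_distrib_left)
  also have "p ^ m * p ^ l + (\<Sum>R\<le>m. ?t m (Suc R) * ?t l (Suc R)) = from_a p q m l"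
  proof -
    have "from_a p q m l = (\<Sum>R\<le>Suc m. ?t m R * ?t l R)" by (simp add: from_a_def binom_term_eq_0)
    then show ?thesis by (subst (asm) sum.atMost_Suc_shift) simp
  qed
  finally show ?thesis .
qed

lemma from_b_Suc: "from_b p q m (Suc l) = p * from_b p q m l + q * from_a p q m l"
  by (simp add: from_a_def from_b_def binom_term_Suc_Suc algebra_simps sum.distrib sum_distrib_left)

lemma from_a_0: "from_a p q 0 l = p ^ l"
  by (simp add: from_a_def)

lemma from_b_0: "from_b p q m 0 = 0"
  by (simp add: from_b_def binom_term_eq_0)

lemma from_nonneg: "0 \<le> p \<Longrightarrow> 0 \<le> q \<Longrightarrow> 0 \<le> from_a p q m l" "0 \<le> p \<Longrightarrow> 0 \<le> q \<Longrightarrow> 0 \<le> from_b p q m l"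
  by (auto simp: from_a_def from_b_def intro!: sum_nonneg mult_nonneg_nonneg binom_term_nonneg)

text \<open>\<open>(p + q) ^ (2 * m)\<close> sums over crossing numbers chosen independently at the
  two points, whereas alternation forces them to agree. Restricting to equal numbers costs at most
  the number \<open>m + 1\<close> of terms.\<close>

lemma from_a_diag_ge: "(p + q) ^ (2 * m) / real (Suc m) \<le> from_a p q m m"
proof -
  let ?t = "binom_term p q m"
  have "(p + q) ^ m = (\<Sum>R\<le>m. ?t R)"
    unfolding binom_term_def by (subst add.commute) (rule binomial_ring)
  then have "((p + q) ^ m)\<^sup>2 = (\<Sum>R\<le>m. ?t R * 1)\<^sup>2" by simp
  also have "\<dots> \<le> (\<Sum>R\<le>m. (?t R)\<^sup>2) * (\<Sum>R\<le>m. 1\<^sup>2)"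
    by (rule Cauchy_Schwarz_ineq_sum)
  also have "\<dots> = from_a p q m m * real (Suc m)"
    by (simp add: from_a_def power2_eq_square)
  finally show ?thesis by (simp add: divide_le_eq power_mult[symmetric] mult.commute)
qed

text \<open>The combination \<open>fa\<close> (\<open>fb\<close>) of the two shifted kernels is \<open>1\<close> at \<open>a\<close> (\<open>b\<close>), \<open>0\<close> at the other
  point and nonpositive off the disc, so \<open>u\<close> below is a subsolution of the recursion for \<open>count_prob\<close>;
  \<open>1 - s\<close> and \<open>r\<close> bound from below the probabilities to return to the same point and to
  cross to the other one. The gap \<open>C\<close> absorbs the non-constancy of the kernel on the boundary of
  the disc.\<close>

lemma pair_prob_ge:
  fixes A C :: real
  assumes ab: "a \<in> disc n" "b \<in> disc n" "a \<noteq> b" and k: "1 \<le> k"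
    and low: "\<And>z. z \<in> disc_nb n \<Longrightarrow> z \<notin> disc n \<Longrightarrow> A \<le> pot (z - a) \<and> A \<le> pot (z - b)"
    and upp: "\<And>z. z \<in> disc_nb n \<Longrightarrow> pot (z - a) \<le> A + C \<and> pot (z - b) \<le> A + C"
    and C: "0 \<le> C"
  defines "d \<equiv> pot (a - b)" and "B \<equiv> A - pot (a - b)"
  defines "s \<equiv> (A + C) / (d * (A + B + C))" and "r \<equiv> B / (d * (A + B + C))"
  assumes d: "0 < d" and B: "0 < B" and s: "s \<le> 1"
    and \<phi>a: "\<phi> \<le> s * (A - pot a) - r * (A + C - pot b)"
    and \<phi>b: "\<phi> \<le> s * (A - pot b) - r * (A + C - pot a)" and \<phi>: "0 \<le> \<phi>"
  shows "1 / (s * A) * (1 - s) * r * ((1 - s + r) ^ (2 * (k - 1)) / real k) * \<phi> \<le> pair_prob n k a b"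
proof -
  \<comment> \<open>Equivalently, \<open>fa z\<close> is s (A - pot (z - a)) - r (A + C - pot (z -
    b)). Off the disc the first bracket is nonpositive and the second nonnegative, which is why one
    constant is \<open>A\<close> and the other \<open>A + C\<close>.\<close>
  define fa where "fa z = (s * A - r * (A + C)) + (-s) * pot (z - a) + r * pot (z - b)" for z
  define fb where "fb z = (s * A - r * (A + C)) + r * pot (z - a) + (-s) * pot (z - b)" for z
  define \<kappa> where "\<kappa> = 1 / (s * A)"
  define p where "p = 1 - s"
  have AB: "A = B + d" by (simp add: B_def d_def)
  have pos: "0 < A" "0 < A + B + C" using AB B C d by auto
  have Den: "0 < d * (A + B + C)" using d pos by simp
  have sr: "0 < s" "0 < r" unfolding s_def r_def using Den B C pos by (auto intro!: divide_pos_pos)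
  have \<kappa>: "0 < \<kappa>" using sr pos by (simp add: \<kappa>_def)
  have p: "0 \<le> p" using s by (simp add: p_def)
  have p0: "pot (a - a) = 0" for a using pot_0 by (simp add: zero_prod_def)
  \<comment> \<open>With \<open>e0\<close> this is the linear system for \<open>s\<close> and
    \<open>r\<close> that expresses fa a = 1 and fa b = 0.\<close>
  have e1: "s * A - r * (B + C) = 1"
  proof -
    have "s * A - r * (B + C) = ((A + C) * A - B * (B + C)) / (d * (A + B + C))"
      by (simp add: s_def r_def diff_divide_distrib)
    also have "(A + C) * A - B * (B + C) = d * (A + B + C)" unfolding AB by (simp add: algebra_simps)
    finally show ?thesis using d pos by simp
  qed
  have e0: "s * B = r * (A + C)" by (simp add: s_def r_def)
  have vals: "fa a = 1" "fa b = 0" "fb a = 0" "fb b = 1"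
    using e0 e1 p0 pot_minus_commute[of a b] unfolding fa_def fb_def AB d_def
    by (simp_all add: algebra_simps)
  have avg: "avg4 fa y = fa y - s * of_bool (y = a) + r * of_bool (y = b)"
    "avg4 fb y = fb y + r * of_bool (y = a) - s * of_bool (y = b)" for y
    unfolding fa_def[abs_def] fb_def[abs_def] avg4_lincomb avg4_pot by (simp_all add: algebra_simps)
  have neg: "fa z \<le> 0" "fb z \<le> 0" if "z \<in> disc_nb n" "z \<notin> disc n" for z
  proof -
    have "0 \<le> s * (pot (z - a) - A)" "0 \<le> s * (pot (z - b) - A)"
      "0 \<le> r * (A + C - pot (z - a))" "0 \<le> r * (A + C - pot (z - b))"
      using low[OF that] upp[OF that(1)] sr by (auto intro!: mult_nonneg_nonneg)
    then show "fa z \<le> 0" "fb z \<le> 0" unfolding fa_def fb_def by (simp_all add: algebra_simps)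
  qed
  have fb1: "\<kappa> * fb z \<le> 1" if "z \<in> disc_nb n" for z
  proof -
    have "0 \<le> s * pot (z - b)" "0 \<le> r * (A + C - pot (z - a))"
      using upp[OF that] sr pot_nonneg[of "z - b"] by (auto intro!: mult_nonneg_nonneg)
    then have "fb z \<le> s * A" unfolding fb_def by (simp add: algebra_simps)
    then show ?thesis using sr pos by (simp add: \<kappa>_def divide_le_eq_1)
  qed
  \<comment> \<open>In the histories counted here the last departure from \<open>a\<close> crosses
    (weight \<open>r\<close>) and the last one from \<open>b\<close> returns (weight
    \<open>p\<close>): hence the factor \<open>p * r\<close> and both shifts by one. They end at
    \<open>b\<close>, where state (0,0) leaves \<kappa> fb, and \<kappa> = 1 / (s A) keeps this
    below 1.\<close>
  define U where "U i j = (if i = 0 \<or> j = 0 then 0 else \<kappa> * p * r * from_a p r (i - 1) (j - 1))" for i j :: nat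
  define V where "V i j = (if i = 0 then \<kappa> * p ^ j else if j = 0 then 0 else \<kappa> * p * r * from_b p r (i - 1) (j - 1))" for i j :: nat
  have UV: "0 \<le> U i j" "0 \<le> V i j" for i j
    unfolding U_def V_def using \<kappa> p sr from_nonneg[of p r] by auto
  have recU: "U i j \<le> p * U (i - 1) j + r * V (i - 1) j" for i j
  proof (cases "i = 0 \<or> j = 0")
    case True
    then show ?thesis using UV p sr by (simp add: U_def[of i j])
  next
    case False
    then obtain i' j' where ij: "i = Suc i'" "j = Suc j'" by (metis not0_implies_Suc)
    show ?thesis
    proof (cases i')
      case 0 then show ?thesis using ij by (simp add: U_def V_def from_a_0)
    next
      case (Suc m)
      then show ?thesis using ij by (simp add: U_def V_def from_a_Suc algebra_simps)
    qed
  qed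
  have recV: "V i j \<le> p * V i (j - 1) + r * U i (j - 1)" if "(i,j) \<noteq> (0,0)" for i j
  proof (cases "j = 0")
    case True
    then show ?thesis using that by (simp add: U_def V_def)
  next
    case False
    then obtain l where j: "j = Suc l" by (metis not0_implies_Suc)
    show ?thesis
    proof (cases "i = 0")
      case True then show ?thesis using j by (simp add: U_def V_def)
    next
      case i: False
      show ?thesis
      proof (cases l)
        case 0 then show ?thesis using i j by (simp add: U_def V_def from_b_0)
      next
        case (Suc l')
        then show ?thesis using i j by (simp add: U_def V_def from_b_Suc algebra_simps)
      qed
    qed
  qed
  define u where "u y t = 0 + U (fst t) (snd t) * fa y + V (fst t) (snd t) * fb y" for y t
  let ?S = "{..k} \<times> {..k}"
  \<comment> \<open>Any finite bound for \<open>u\<close> will do, since it is multiplied by a power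
    of \<open>exit_rate n\<close> that tends to 0.\<close>
  define M where "M = (\<Sum>(y,t)\<in>disc_nb n \<times> ?S. \<bar>u y t\<bar>)"
  have fin: "finite (disc_nb n \<times> ?S)" by (simp add: finite_disc_nb)
  have M0: "0 \<le> M" unfolding M_def by (intro sum_nonneg) auto
  have uM: "u y t \<le> M" if "y \<in> disc_nb n" "t \<in> ?S" for y t
  proof -
    have "\<bar>u y t\<bar> = (\<lambda>(y,t). \<bar>u y t\<bar>) (y,t)" by simp
    also have "\<dots> \<le> M" unfolding M_def by (rule member_le_sum) (use that fin in auto)
    finally show ?thesis by simp
  qed
  \<comment> \<open>Averaging turns the values (1, 0) of (fa, fb) at \<open>a\<close> into (p, r),
    and (0, 1) at \<open>b\<close> into (r, p), so the claim there is \<open>recU\<close> or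
    \<open>recV\<close>. Elsewhere both functions are harmonic and the state stays.\<close>
  have sub: "u y t \<le> avg4 (\<lambda>z. u z (count_dec a b y t)) y" if t: "t \<noteq> (0,0)" for y t
  proof -
    obtain i j where ij: "t = (i,j)" by fastforce
    consider "y = a" | "y = b" | "y \<noteq> a" "y \<noteq> b" by blast
    then show ?thesis
    proof cases
      case 1
      have "avg4 (\<lambda>z. u z (count_dec a b y t)) y = p * U (i - 1) j + r * V (i - 1) j"
        unfolding u_def avg4_lincomb avg vals 1 ij using ab(3) by (simp add: count_dec_def p_def vals mult.commute)
      moreover have "u y t = U i j" using 1 vals by (simp add: u_def ij)
      ultimately show ?thesis using recU[of i j] by simp
    next
      case 2
      have "avg4 (\<lambda>z. u z (count_dec a b y t)) y = p * V i (j - 1) + r * U i (j - 1)"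
        unfolding u_def avg4_lincomb avg vals 2 ij using ab(3) by (simp add: count_dec_def p_def vals mult.commute)
      moreover have "u y t = V i j" using 2 vals by (simp add: u_def ij)
      ultimately show ?thesis using recV[of i j] t ij by simp
    next
      case 3
      then show ?thesis unfolding u_def avg4_lincomb avg by (simp add: count_dec_def)
    qed
  qed
  have lower: "u (0,0) (k,k) - M * exit_rate n ^ T * exit_fun n (0,0) \<le> pair_prob n k a b" for T
  proof (rule order_trans[OF _ pair_prob_bounds(1)[OF ab(1,2)]])
    show "u (0,0) (k,k) - M * exit_rate n ^ T * exit_fun n (0,0) \<le> count_prob n a b T (0,0) (k,k)"
    proof (rule run_prob_ge[where E = "disc_nb n" and S = ?S])
      show "u y t \<le> 1" if "y \<in> disc_nb n" "t = (0,0)" for y t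
        using fb1[OF that(1)] that(2) by (simp add: u_def U_def V_def)
      show "u y t \<le> 0" if "y \<in> disc_nb n" "y \<notin> disc n" for y t
        using neg[OF that] UV by (auto simp: u_def intro!: add_nonpos_nonpos mult_nonneg_nonpos)
      show "count_dec a b y t \<in> ?S" if "t \<in> ?S" for y t using that by (auto simp: count_dec_def)
    qed (use uM sub M0 exit_rate exit_fun_ge avg4_exit_fun disc_nb_step zero_in_disc in \<open>auto simp: disc_nb_def\<close>)
  qed
  have "(\<lambda>T. u (0,0) (k,k) - M * exit_rate n ^ T * exit_fun n (0,0)) \<longlonglongrightarrow> u (0,0) (k,k) - M * 0 * exit_fun n (0,0)"
    using exit_rate[of n] by (intro tendsto_intros LIMSEQ_power_zero) auto
  then have "u (0,0) (k,k) \<le> pair_prob n k a b"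
    using lower by (intro LIMSEQ_le_const2[where x = "u (0,0) (k,k)"]) auto
  moreover have "\<kappa> * p * r * ((p + r) ^ (2 * (k - 1)) / real k) * \<phi> \<le> u (0,0) (k,k)"
  proof -
    have pm: "pot ((0,0) - z) = pot z" for z
      using pot_minus_commute[of z "(0,0)"] by (simp flip: zero_prod_def)
    have f0: "\<phi> \<le> fa (0,0)" "\<phi> \<le> fb (0,0)"
      using \<phi>a \<phi>b unfolding fa_def fb_def pm by (simp_all add: algebra_simps)
    have "\<kappa> * p * r * ((p + r) ^ (2 * (k - 1)) / real k) \<le> \<kappa> * p * r * from_a p r (k - 1) (k - 1)"
      using from_a_diag_ge[of p r "k - 1"] k \<kappa> p sr by (intro mult_left_mono) auto
    also have "\<dots> = U k k" using k by (simp add: U_def)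
    finally have "\<kappa> * p * r * ((p + r) ^ (2 * (k - 1)) / real k) * \<phi> \<le> U k k * fa (0,0)"
      using f0 \<phi> UV by (intro mult_mono) auto
    also have "\<dots> \<le> u (0,0) (k,k)" using f0 \<phi> UV[of k k] by (simp add: u_def)
    finally show ?thesis .
  qed
  ultimately show ?thesis by (simp add: \<kappa>_def p_def)
qed

section \<open>Upper bound for the expectation\<close>

definition emb :: "pt \<Rightarrow> real \<times> real" where "emb z = (of_int (fst z), of_int (snd z))"

lemma zdist_dist: "zdist x y = dist (emb x) (emb y)"
  by (simp add: zdist_def emb_def dist_prod_def dist_real_def)

lemma zdist_triangle: "zdist x z \<le> zdist x y + zdist y z"
  unfolding zdist_dist by (rule dist_triangle)

lemma zdist_commute: "zdist x y = zdist y x"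
  unfolding zdist_dist by (rule dist_commute)

lemma zdist_minus: "zdist (x - y) (0,0) = zdist x y"
  by (simp add: zdist_def)

lemma zdist_square: "(zdist x y)\<^sup>2 = norm2 (x - y)"
  unfolding zdist_def norm2_def by (subst real_sqrt_pow2) (simp_all only: of_int_0_le_iff, auto)

lemma zdist_ge_1: "x \<noteq> y \<Longrightarrow> 1 \<le> zdist x y"
proof -
  assume "x \<noteq> y"
  then have "0 < (fst x - fst y)\<^sup>2 + (snd x - snd y)\<^sup>2"
    by (auto simp: prod_eq_iff sum_power2_gt_zero_iff)
  then have "(1::int) \<le> (fst x - fst y)\<^sup>2 + (snd x - snd y)\<^sup>2" by linarith
  then have "1 \<le> real_of_int ((fst x - fst y)\<^sup>2 + (snd x - snd y)\<^sup>2)" by (simp only: of_int_1_le_iff)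
  then show ?thesis by (simp add: zdist_def)
qed

lemma zdist_disc_nb:
  assumes "z \<in> disc_nb n" shows "zdist z (0,0) \<le> real n + 1"
proof (rule power2_le_imp_le)
  have "z - (0,0) = z" by (simp add: prod_eq_iff)
  then show "(zdist z (0,0))\<^sup>2 \<le> (real n + 1)\<^sup>2"
    unfolding zdist_square using norm2_disc_nb[OF assms] by simp
qed simp

lemma pot_diff_bounds:
  assumes "x \<noteq> y"
  shows "\<bar>pot (x - y) - 2/pi * ln (zdist x y)\<bar> \<le> 12"
proof -
  have "x - y \<noteq> (0,0)" using assms by (simp add: prod_eq_iff)
  then show ?thesis using pot_asymp[of "x - y"] by (simp add: zdist_minus)
qed

lemma pot_diff_le:
  assumes "zdist x y \<le> M" "1 \<le> M"
  shows "pot (x - y) \<le> 2/pi * ln M + 12"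
proof (cases "x = y")
  case True
  then show ?thesis using pot_0 assms by (simp add: zero_prod_def)
next
  case False
  have "ln (zdist x y) \<le> ln M" using zdist_ge_1[OF False] assms by (subst ln_le_cancel_iff) auto
  then have "2/pi * ln (zdist x y) \<le> 2/pi * ln M" by (intro mult_left_mono) auto
  then show ?thesis using pot_diff_bounds[OF False] by linarith
qed

text \<open>Here |z - a| \<le> 2 n + 1 \<le> 3 n, and (2/pi) ln 3 \<le> 2 raises the error from 12
  to 14.\<close>

lemma pot_disc_le:
  assumes "z \<in> disc_nb n" "a \<in> disc n" "1 \<le> n"
  shows "pot (z - a) \<le> 2/pi * ln (real n) + 14"
proof -
  have "zdist z a \<le> zdist z (0,0) + zdist (0,0) a" by (rule zdist_triangle)
  also have "\<dots> \<le> 3 * real n" using zdist_disc_nb[OF assms(1)] assms by (simp add: zdisc_def)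
  finally have "pot (z - a) \<le> 2/pi * ln (3 * real n) + 12" using assms by (intro pot_diff_le) auto
  also have "ln (3 * real n) = ln 3 + ln (real n)" using assms by (simp add: ln_mult)
  also have "2/pi * (ln 3 + ln (real n)) \<le> 2/pi * (2 + ln (real n))"
    using ln_le_minus_one[of 3] by (intro mult_left_mono) auto
  also have "\<dots> \<le> 2/pi * ln (real n) + 2"
    using pi_gt3 by (simp add: distrib_left field_simps)
  finally show ?thesis by simp
qed

text \<open>With t = 2 - \<gamma> and q = sqrt (2 \<alpha>) the exponent is 6 - 2 (t + q^2 / t). The
  bracket has its minimum 2 q at t = q and increases beyond, so the constraint t \<ge> 2 - \<beta>
  binds when 2 - \<beta> \<ge> q.\<close>

lemma rho2_ge:
  assumes \<alpha>: "0 < \<alpha>" "\<alpha> < 1" and \<gamma>: "0 \<le> \<gamma>" "\<gamma> \<le> \<beta>" "\<beta> < 1"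
  shows "2 + 2 * \<gamma> - 4 * \<alpha> / (2 - \<gamma>) \<le> rho2 \<alpha> \<beta>"
proof -
  define q where "q = sqrt (2 * \<alpha>)"
  have q: "0 < q" "q\<^sup>2 = 2 * \<alpha>" using \<alpha> by (auto simp: q_def)
  define t where "t = 2 - \<gamma>"
  have t: "0 < t" "1 < t" using \<gamma> by (auto simp: t_def)
  have eq: "2 + 2 * \<gamma> - 4 * \<alpha> / (2 - \<gamma>) = 6 - 2 * (t + q\<^sup>2 / t)"
    unfolding q(2) by (simp add: t_def)
  show ?thesis
  proof (cases "\<beta> \<le> 2 - q")
    case True
    define b where "b = 2 - \<beta>"
    have b: "q \<le> b" "b \<le> t" "0 < b" using True \<gamma> by (auto simp: b_def t_def)
    have "q * q \<le> b * t" using b q by (intro mult_mono) auto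
    \<comment> \<open>This is b t times the increment of t + q^2 / t from \<open>b\<close> to
      \<open>t\<close>.\<close>
    then have "0 \<le> (t - b) * (b * t - q * q)" using b by (intro mult_nonneg_nonneg) auto
    then have "(b + q\<^sup>2 / b) \<le> (t + q\<^sup>2 / t)"
      using b t by (simp add: field_simps power2_eq_square)
    moreover have "rho2 \<alpha> \<beta> = 6 - 2 * (b + q\<^sup>2 / b)"
      using True unfolding q(2) by (simp add: rho2_def q_def b_def)
    moreover have "6 - 2 * (t + q\<^sup>2 / t) \<le> 6 - 2 * (b + q\<^sup>2 / b)"
      by (intro diff_left_mono mult_left_mono calculation(1)) simp
    ultimately show ?thesis unfolding eq by (simp only:)
  next
    case False
    have "0 \<le> (t - q)\<^sup>2" by simp
    then have "2 * q * t \<le> t * t + q\<^sup>2" by (simp add: power2_eq_square algebra_simps)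
    then have "2 * q \<le> t + q\<^sup>2 / t" using t by (simp add: field_simps)
    moreover have "rho2 \<alpha> \<beta> = 6 - 4 * q" using False by (simp add: rho2_def q_def)
    moreover have "6 - 2 * (t + q\<^sup>2 / t) \<le> 6 - 2 * (2 * q)"
      by (intro diff_left_mono mult_left_mono calculation(1)) simp
    ultimately show ?thesis unfolding eq by simp
  qed
qed

section \<open>Sums of |z|^(-2) over a box\<close>

lemma sum_inverse_interval:
  "(\<Sum>j\<in>{-int m..int m}. 1 / (of_int \<bar>j\<bar> + 1)) \<le> 2 * (1 + ln (real m + 1))"
proof -
  let ?f = "\<lambda>j::int. 1 / (real_of_int \<bar>j\<bar> + 1)"
  let ?A = "int ` {..m}" and ?B = "(\<lambda>k. - int k) ` {..m}"
  have sub: "{-int m..int m} \<subseteq> ?A \<union> ?B"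
  proof
    fix j assume j: "j \<in> {-int m..int m}"
    show "j \<in> ?A \<union> ?B"
    proof (cases "0 \<le> j")
      case True then have "j = int (nat j)" "nat j \<le> m" using j by auto
      then show ?thesis by blast
    next
      case False then have "j = - int (nat (-j))" "nat (-j) \<le> m" using j by auto
      then show ?thesis by blast
    qed
  qed
  have "sum ?f {-int m..int m} \<le> sum ?f (?A \<union> ?B)" by (rule sum_mono2[OF _ sub]) auto
  also have "\<dots> \<le> sum ?f ?A + sum ?f ?B"
  proof -
    have "sum ?f (?A \<union> ?B) + sum ?f (?A \<inter> ?B) = sum ?f ?A + sum ?f ?B" by (rule sum.union_inter) auto
    moreover have "0 \<le> sum ?f (?A \<inter> ?B)" by (intro sum_nonneg) auto
    ultimately show ?thesis by linarith
  qed
  also have "\<dots> = 2 * (\<Sum>k\<le>m. 1 / (real k + 1))"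
    by (subst (1 2) sum.reindex) (auto simp: inj_on_def)
  also have "(\<Sum>k\<le>m. 1 / (real k + 1)) = harm (Suc m)"
    by (simp add: harm_altdef lessThan_Suc_atMost divide_inverse add.commute)
  also have "harm (Suc m) \<le> 1 + ln (real m + 1)"
    using euler_mascheroni_sequence_decreasing[of 1 "Suc m"] by (simp add: harm_expand add.commute)
  finally show ?thesis by simp
qed

text \<open>A product bound lets the planar sum factor into two harmonic sums. It costs one
  logarithm against the true order ln m, invisible in the exponent. The value 1 at the origin stands
  for pairs with a = b.\<close>

lemma inverse_norm2_le:
  "(if z = (0,0) then 1 else 1 / norm2 z) \<le> 4 * (1 / (of_int \<bar>fst z\<bar> + 1) * (1 / (of_int \<bar>snd z\<bar> + 1)))"
proof (cases "z = (0,0)")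
  case False
  obtain x y where z: "z = (x,y)" by fastforce
  define u v where "u = \<bar>x\<bar>" and "v = \<bar>y\<bar>"
  have uv: "0 \<le> u" "0 \<le> v" "u\<^sup>2 = x\<^sup>2" "v\<^sup>2 = y\<^sup>2" "u \<noteq> 0 \<or> v \<noteq> 0" using False z by (auto simp: u_def v_def)
  have "1 \<le> u\<^sup>2 + v\<^sup>2"
  proof -
    have "0 < u\<^sup>2 + v\<^sup>2" using uv(5) by (simp add: sum_power2_gt_zero_iff)
    then show ?thesis by linarith
  qed
  moreover have "u \<le> u\<^sup>2" "v \<le> v\<^sup>2" using uv(1,2) by (auto simp: power2_eq_square mult_le_cancel_left1)
  moreover have "2 * (u * v) \<le> u\<^sup>2 + v\<^sup>2" using zero_le_power2[of "u - v"] by (simp add: power2_eq_square algebra_simps)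
  ultimately have "(u + 1) * (v + 1) \<le> 4 * (x\<^sup>2 + y\<^sup>2)" unfolding uv(3,4)[symmetric]
    by (simp add: algebra_simps)
  then have "real_of_int ((u + 1) * (v + 1)) \<le> real_of_int (4 * (x\<^sup>2 + y\<^sup>2))" by (simp only: of_int_le_iff)
  then have le: "(real_of_int u + 1) * (real_of_int v + 1) \<le> 4 * norm2 z" by (simp add: norm2_def z)
  have pos: "0 < (real_of_int u + 1) * (real_of_int v + 1)" using uv by (intro mult_pos_pos) auto
  then have "0 < norm2 z" using le by linarith
  then have "1 / norm2 z \<le> 4 / ((real_of_int u + 1) * (real_of_int v + 1))"
    using le pos by (simp add: field_simps)
  then show ?thesis using False by (simp add: z u_def v_def)
qed simp

lemma sum_inverse_norm2:
  fixes m :: nat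
  assumes m: "3 \<le> m"
  shows "(\<Sum>z\<in>{-int (2*m)..int (2*m)} \<times> {-int (2*m)..int (2*m)}. (if z = (0,0) then 1 else 1 / norm2 z)) \<le> 144 * (ln (real m))\<^sup>2"
proof -
  let ?I = "{-int (2*m)..int (2*m)}"
  let ?f = "\<lambda>j::int. 1 / (real_of_int \<bar>j\<bar> + 1)"
  have L: "1 \<le> ln (real m)" using m exp_le by (subst ln_ge_iff) auto
  have "ln (real (2*m) + 1) \<le> ln (3 * real m)" using m by (subst ln_le_cancel_iff) auto
  also have "\<dots> = ln 3 + ln (real m)" using m by (simp add: ln_mult)
  also have "\<dots> \<le> 2 * ln (real m)" using m by simp
  finally have "2 * (1 + ln (real (2*m) + 1)) \<le> 2 * (1 + 2 * ln (real m))" by (intro mult_left_mono add_left_mono) auto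
  also have "\<dots> \<le> 6 * ln (real m)" using L by simp
  finally have l: "2 * (1 + ln (real (2*m) + 1)) \<le> 6 * ln (real m)" .
  have S: "sum ?f ?I \<le> 6 * ln (real m)" using sum_inverse_interval[of "2*m"] l by (rule order_trans)
  have S0: "0 \<le> sum ?f ?I" by (intro sum_nonneg) auto
  have "(\<Sum>z\<in>?I \<times> ?I. (if z = (0,0) then 1 else 1 / norm2 z)) \<le> (\<Sum>z\<in>?I \<times> ?I. 4 * (?f (fst z) * ?f (snd z)))"
    by (intro sum_mono inverse_norm2_le)
  also have "\<dots> = 4 * (\<Sum>z\<in>?I \<times> ?I. ?f (fst z) * ?f (snd z))"
    by (rule sum_distrib_left[symmetric])
  also have "(\<Sum>z\<in>?I \<times> ?I. ?f (fst z) * ?f (snd z)) = sum ?f ?I * sum ?f ?I"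
    by (simp only: sum_product sum.cartesian_product split_def)
  also have "4 * (sum ?f ?I * sum ?f ?I) \<le> 4 * ((6 * ln (real m)) * (6 * ln (real m)))"
  proof -
    have "sum ?f ?I * sum ?f ?I \<le> (6 * ln (real m)) * (6 * ln (real m))"
      by (rule mult_mono[OF S S]) (use S0 L in auto)
    then show ?thesis by (rule mult_left_mono) simp
  qed
  finally show ?thesis by (simp add: power2_eq_square)
qed

lemma disc_subset: "disc n \<subseteq> {-int n..int n} \<times> {-int n..int n}"
proof
  fix z assume "z \<in> disc n"
  then have "real_of_int ((fst z)\<^sup>2 + (snd z)\<^sup>2) \<le> real_of_int ((int n)\<^sup>2)" by (simp add: mem_disc norm2_def)
  then have "(fst z)\<^sup>2 + (snd z)\<^sup>2 \<le> (int n)\<^sup>2" by (simp only: of_int_le_iff)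
  then have "(fst z)\<^sup>2 \<le> (int n)\<^sup>2" "(snd z)\<^sup>2 \<le> (int n)\<^sup>2"
    using zero_le_power2[of "fst z"] zero_le_power2[of "snd z"] by linarith+
  then have "\<bar>fst z\<bar> \<le> int n" "\<bar>snd z\<bar> \<le> int n" by (auto simp: abs_le_square_iff[symmetric])
  then show "z \<in> {-int n..int n} \<times> {-int n..int n}" by (cases z) (auto simp: abs_le_iff)
qed

lemma card_disc_le: "1 \<le> n \<Longrightarrow> real (card (disc n)) \<le> 9 * (real n)\<^sup>2"
proof -
  assume n: "1 \<le> n"
  have "card (disc n) \<le> card ({-int n..int n} \<times> {-int n..int n})" by (intro card_mono disc_subset) auto
  also have "\<dots> = (2 * n + 1) * (2 * n + 1)"
  proof -
    have "nat (2 * int n + 1) = 2 * n + 1" by (simp add: nat_add_distrib nat_mult_distrib)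
    then show ?thesis by (simp add: card_cartesian_product)
  qed
  also have "\<dots> \<le> (3 * n) * (3 * n)" using n by (intro mult_mono) auto
  finally have "real (card (disc n)) \<le> real ((3 * n) * (3 * n))" by (simp only: of_nat_le_iff)
  then show ?thesis by (simp add: power2_eq_square)
qed

abbreviation level :: "real \<Rightarrow> nat \<Rightarrow> nat" where
  "level \<alpha> n \<equiv> nat \<lceil>4 * \<alpha> / pi * (ln (real n))\<^sup>2\<rceil>"

lemma level_ge: "4 * \<alpha> / pi * (ln (real n))\<^sup>2 \<le> real (level \<alpha> n)"
  by linarith

text \<open>The denominator is (2/pi) (L + C) with C = 15 pi / 2, and L^2 / (L + C) \<ge> L - C: the
  additive constant costs only the factor exp (2 \<alpha> C).\<close>

lemma exp_level_one_point:
  assumes L: "1 \<le> L" and \<alpha>: "0 < \<alpha>" and k: "4 * \<alpha> / pi * L\<^sup>2 \<le> k"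
  shows "exp (- k / (15 + 2/pi * L)) \<le> exp (15 * pi * \<alpha>) * exp (- 2 * \<alpha> * L)"
proof -
  define C where "C = 15 * pi / 2"
  have C: "0 < C" by (simp add: C_def)
  have eq: "15 + 2/pi * L = 2/pi * (L + C)" by (simp add: C_def field_simps)
  have "2 * \<alpha> * (L - C) \<le> 2 * \<alpha> * (L\<^sup>2 / (L + C))"
  proof (rule mult_left_mono)
    have "(L - C) * (L + C) \<le> L\<^sup>2" by (simp add: power2_eq_square algebra_simps)
    then show "L - C \<le> L\<^sup>2 / (L + C)" using L C by (simp add: pos_le_divide_eq)
  qed (use \<alpha> in simp)
  also have "\<dots> = (4 * \<alpha> / pi * L\<^sup>2) / (2/pi * (L + C))" using L C by (simp add: field_simps)
  also have "\<dots> \<le> k / (2/pi * (L + C))" using k L C by (intro divide_right_mono) auto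
  finally have "- k / (2/pi * (L + C)) \<le> 2 * \<alpha> * C + - 2 * \<alpha> * L" by (simp add: algebra_simps)
  then show ?thesis unfolding eq mult_exp_exp C_def by (simp add: mult_ac)
qed

text \<open>As for one point, with 2 L - l in the denominator. The 41 collects 1, twice the 14 of
  \<open>pot_disc_le\<close> and the 12 of \<open>pot_diff_bounds\<close>; with C = 41 pi / 2 the
  loss is exp (4 \<alpha> C).\<close>

lemma exp_level_two_point:
  assumes L: "1 \<le> L" and \<alpha>: "0 < \<alpha>" and k: "4 * \<alpha> / pi * L\<^sup>2 \<le> k" and l: "0 \<le> l" "l \<le> L"
    and D: "0 < D" "D \<le> 41 + 2/pi * (2 * L - l)"
  shows "exp (- (2 * k) / D) \<le> exp (82 * pi * \<alpha>) * exp (- 4 * \<alpha> * L\<^sup>2 / (2 * L - l))"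
proof -
  define C where "C = 41 * pi / 2"
  define t where "t = 2 * L - l"
  have C: "0 < C" by (simp add: C_def)
  have t: "L \<le> t" "0 < t" using l L by (auto simp: t_def)
  have eq: "41 + 2/pi * t = 2/pi * (t + C)" by (simp add: C_def field_simps)
  have "4 * \<alpha> * L\<^sup>2 / t - 4 * \<alpha> * C \<le> 4 * \<alpha> * L\<^sup>2 / (t + C)"
  proof -
    have "L\<^sup>2 / t - L\<^sup>2 / (t + C) = L\<^sup>2 * C / (t * (t + C))" using t C by (simp add: field_simps)
    also have "\<dots> \<le> (t * (t + C)) * C / (t * (t + C))"
    proof (intro divide_right_mono mult_right_mono)
      show "L\<^sup>2 \<le> t * (t + C)" unfolding power2_eq_square using t C L by (intro mult_mono) auto
    qed (use t C in auto)
    also have "\<dots> = C" using t C by simp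
    finally have "4 * \<alpha> * (L\<^sup>2 / t - L\<^sup>2 / (t + C)) \<le> 4 * \<alpha> * C" using \<alpha> by (intro mult_left_mono) auto
    then show ?thesis by (simp add: right_diff_distrib)
  qed
  also have "4 * \<alpha> * L\<^sup>2 / (t + C) = 2 * (4 * \<alpha> / pi * L\<^sup>2) / (2/pi * (t + C))" using t C by (simp add: field_simps)
  also have "\<dots> \<le> 2 * k / (2/pi * (t + C))" using k t C by (intro divide_right_mono) auto
  also have "\<dots> \<le> 2 * k / D"
  proof (rule divide_left_mono)
    have "D \<le> 41 + 2/pi * t" using D(2) by (simp only: t_def)
    then show "D \<le> 2/pi * (t + C)" by (simp only: eq)
    have "0 \<le> 4 * \<alpha> / pi * L\<^sup>2" using \<alpha> by simp
    then show "0 \<le> 2 * k" using k by linarith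
  qed (use D t C in auto)
  finally have "- (2 * k) / D \<le> 4 * \<alpha> * C + - 4 * \<alpha> * L\<^sup>2 / t" by simp
  then show ?thesis unfolding mult_exp_exp C_def t_def by (simp add: mult_ac)
qed

lemma pair_prob_le_decay:
  assumes \<alpha>: "0 < \<alpha>" "\<alpha> < 1" and \<beta>: "0 < \<beta>" "\<beta> < 1" and n: "3 \<le> n"
    and ab: "a \<in> disc n" "b \<in> disc n" "zdist a b \<le> real n powr \<beta>"
  shows "pair_prob n (level \<alpha> n) a b \<le> 31 * exp (82 * pi * \<alpha>) * ln (real n) * real n powr (rho2 \<alpha> \<beta> - 2)
    * (if b - a = (0,0) then 1 else 1 / norm2 (b - a))"
proof -
  define L where "L = ln (real n)"
  define A where "A = 2/pi * L + 14"
  define R where "R = rho2 \<alpha> \<beta>"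
  have L: "1 \<le> L" unfolding L_def using n exp_le by (subst ln_ge_iff) auto
  have A: "0 < A" using L by (simp add: A_def add_pos_pos)
  have A31: "1 + 2 * A \<le> 31 * L" "1 + A \<le> 31 * L"
  proof -
    define x where "x = 2/pi * L"
    have "x \<le> 1 * L" unfolding x_def using L pi_gt3 by (intro mult_right_mono) auto
    then show "1 + 2 * A \<le> 31 * L" "1 + A \<le> 31 * L" using L unfolding A_def x_def[symmetric] distrib_left by linarith+
  qed
  have pa: "pot (z - a) \<le> A" "pot (z - b) \<le> A" if "z \<in> disc_nb n" for z
    using pot_disc_le[OF that] ab n by (auto simp: A_def L_def)
  have nR: "real n powr (R - 2) = exp ((R - 2) * L)" using n by (simp add: powr_def L_def)
  have k: "4 * \<alpha> / pi * L\<^sup>2 \<le> real (level \<alpha> n)" unfolding L_def by (rule level_ge)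
  show ?thesis
  proof (cases "a = b")
    case True
    have "pair_prob n (level \<alpha> n) a b \<le> (1 + A) * exp (- real (level \<alpha> n) / (1 + A))"
      by (intro pair_prob_le_one_point ab A pa)
    also have "1 + A = 15 + 2/pi * L" by (simp add: A_def)
    also have "(15 + 2/pi * L) * exp (- real (level \<alpha> n) / (15 + 2/pi * L)) \<le> (31 * L) * (exp (15 * pi * \<alpha>) * exp (- 2 * \<alpha> * L))"
      using A31 L by (intro mult_mono exp_level_one_point k \<alpha>) (auto simp: A_def)
    also have "\<dots> \<le> (31 * L) * (exp (82 * pi * \<alpha>) * exp ((R - 2) * L))"
    proof (intro mult_left_mono mult_mono)
      \<comment> \<open>The diagonal obeys the case \<gamma> = 0 of the exponent bound, that is - 2
        \<alpha> \<le> R - 2.\<close>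
      have "2 + 2 * 0 - 4 * \<alpha> / (2 - 0) \<le> R" unfolding R_def by (intro rho2_ge \<alpha> \<beta>) (use \<beta> in auto)
      then have "- 2 * \<alpha> * L \<le> (R - 2) * L" using L by (intro mult_right_mono) auto
      then show "exp (- 2 * \<alpha> * L) \<le> exp ((R - 2) * L)" by simp
    qed (use L \<alpha> in auto)
    finally show ?thesis using True unfolding nR[unfolded R_def] R_def L_def by (simp add: mult_ac zero_prod_def)
  next
    case False
    define l where "l = ln (zdist a b)"
    have d1: "1 \<le> zdist a b" using False by (rule zdist_ge_1)
    have l0: "0 \<le> l" using d1 by (simp add: l_def)
    have "l \<le> ln (real n powr \<beta>)" unfolding l_def using d1 ab(3) n by (subst ln_le_cancel_iff) auto
    then have l\<beta>: "l \<le> \<beta> * L" using n by (simp add: ln_powr L_def)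
    have lL: "l \<le> L"
    proof -
      have "\<beta> * L \<le> 1 * L" using L \<beta> by (intro mult_right_mono) auto
      then show ?thesis using l\<beta> by simp
    qed
    have pab: "\<bar>pot (a - b) - 2/pi * l\<bar> \<le> 12" unfolding l_def by (rule pot_diff_bounds[OF False])
    have pA: "pot (a - b) \<le> A" using pa(2)[of a] ab by (simp add: disc_nb_def)
    have "pair_prob n (level \<alpha> n) a b \<le> (1 + 2 * A) * exp (- (2 * real (level \<alpha> n)) / (1 + 2 * A - pot (a - b)))"
    proof (rule pair_prob_le_two_point[OF ab(1,2) False])
      show "0 < 2 * A - pot (a - b)" using pA A by linarith
    qed (use pa in blast)+
    also have "\<dots> \<le> (31 * L) * (exp (82 * pi * \<alpha>) * exp (- 4 * \<alpha> * L\<^sup>2 / (2 * L - l)))"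
    proof (intro mult_mono exp_level_two_point k l0 lL L \<alpha> A31)
      show "0 < 1 + 2 * A - pot (a - b)" using pA A by linarith
      define c where "c = 2/pi"
      have e: "c * (2 * L - l) = 2 * (c * L) - c * l" by (simp add: algebra_simps)
      have "1 + 2 * (c * L + 14) - pot (a - b) \<le> 41 + (2 * (c * L) - c * l)"
        using pab unfolding c_def[symmetric] by (simp add: abs_le_iff)
      then show "1 + 2 * A - pot (a - b) \<le> 41 + 2/pi * (2 * L - l)"
        unfolding A_def c_def[symmetric] e .
    qed (use L in auto)
    also have "\<dots> \<le> (31 * L) * (exp (82 * pi * \<alpha>) * exp ((R - 2) * L - 2 * l))"
    proof (intro mult_left_mono)
      \<comment> \<open>The exact exponent of the distance: \<open>zdist a b\<close> is n^\<gamma>.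
        The term 2 \<gamma> of \<open>rho2_ge\<close> becomes the factor
        \<open>1 / norm2 (b - a)\<close>.\<close>
      define \<gamma> where "\<gamma> = l / L"
      have g: "0 \<le> \<gamma>" "\<gamma> \<le> \<beta>" using l0 l\<beta> L by (auto simp: \<gamma>_def divide_le_eq)
      have lg: "l = \<gamma> * L" using L by (simp add: \<gamma>_def)
      have g2: "0 < 2 - \<gamma>" using g \<beta> by linarith
      have "2 + 2 * \<gamma> - 4 * \<alpha> / (2 - \<gamma>) \<le> R" unfolding R_def by (intro rho2_ge \<alpha> \<beta> g)
      then have "(- 4 * \<alpha> / (2 - \<gamma>)) * L \<le> (R - 2 - 2 * \<gamma>) * L" using L by (intro mult_right_mono) auto
      moreover have "- 4 * \<alpha> * L\<^sup>2 / (2 * L - l) = (- 4 * \<alpha> / (2 - \<gamma>)) * L"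
      proof -
        have "2 * L - l = (2 - \<gamma>) * L" by (simp add: lg algebra_simps)
        then show ?thesis using g2 L by (simp add: power2_eq_square)
      qed
      ultimately have "- 4 * \<alpha> * L\<^sup>2 / (2 * L - l) \<le> (R - 2) * L - 2 * l" by (simp add: lg algebra_simps)
      then show "exp (- 4 * \<alpha> * L\<^sup>2 / (2 * L - l)) \<le> exp ((R - 2) * L - 2 * l)" by simp
    qed (use L in auto)
    also have "exp ((R - 2) * L - 2 * l) = exp ((R - 2) * L) * (1 / norm2 (b - a))"
    proof -
      have "exp (2 * l) = exp l * exp l" by (simp add: mult_exp_exp)
      also have "\<dots> = (zdist b a)\<^sup>2" using d1 zdist_commute[of a b] by (simp add: l_def power2_eq_square)
      finally have "exp (2 * l) = norm2 (b - a)" by (simp add: zdist_square)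
      then show ?thesis by (simp add: exp_diff)
    qed
    finally show ?thesis using False unfolding nR[unfolded R_def] R_def L_def by (simp add: mult_ac flip: zero_prod_def)
  qed
qed

lemma expectation_upper:
  assumes \<alpha>: "0 < \<alpha>" "\<alpha> < 1" and \<beta>: "0 < \<beta>" "\<beta> < 1" and n: "3 \<le> n"
  shows "integral\<^sup>L srw_space (\<lambda>\<omega>. real (close_pairs n \<alpha> \<beta> \<omega>))
    \<le> 40176 * exp (82 * pi * \<alpha>) * (ln (real n)) ^ 3 * real n powr rho2 \<alpha> \<beta>"
proof -
  define L where "L = ln (real n)"
  define H where "H = 31 * exp (82 * pi * \<alpha>) * L * real n powr (rho2 \<alpha> \<beta> - 2)"
  define w where "w z = (if z = (0,0) then 1 else 1 / norm2 z)" for z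
  have L: "1 \<le> L" unfolding L_def using n exp_le by (subst ln_ge_iff) auto
  have w0: "0 \<le> w z" for z unfolding w_def norm2_def by simp
  have H0: "0 \<le> H" using L by (simp add: H_def)
  let ?I = "{-int (2*n)..int (2*n)} \<times> {-int (2*n)..int (2*n)}"
  let ?Q = "{p. fst p \<in> disc n \<and> snd p \<in> disc n \<and> zdist (fst p) (snd p) \<le> real n powr \<beta>}"
  have "integral\<^sup>L srw_space (\<lambda>\<omega>. real (close_pairs n \<alpha> \<beta> \<omega>)) = (\<Sum>p\<in>?Q. pair_prob n (level \<alpha> n) (fst p) (snd p))"
    by (rule integral_close_pairs)
  also have "\<dots> \<le> (\<Sum>p\<in>?Q. H * w (snd p - fst p))"
    unfolding H_def w_def L_def by (intro sum_mono pair_prob_le_decay \<alpha> \<beta> n) auto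
  \<comment> \<open>The restriction to distance n^\<beta> is already encoded in the exponent
    \<open>rho2\<close>, so the sum may run over all pairs.\<close>
  also have "\<dots> \<le> (\<Sum>p\<in>disc n \<times> disc n. H * w (snd p - fst p))"
    by (rule sum_mono2) (use finite_disc w0 H0 in auto)
  also have "\<dots> = (\<Sum>a\<in>disc n. \<Sum>b\<in>disc n. H * w (b - a))"
    by (subst sum.cartesian_product) (simp add: split_def)
  also have "\<dots> \<le> (\<Sum>a\<in>disc n. H * (144 * L\<^sup>2))"
  proof (rule sum_mono)
    fix a assume a: "a \<in> disc n"
    have "(\<Sum>b\<in>disc n. w (b - a)) = sum w ((\<lambda>b. b - a) ` disc n)"
      by (subst sum.reindex) (auto simp: inj_on_def)
    also have "\<dots> \<le> sum w ?I"
    proof (rule sum_mono2)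
      show "(\<lambda>b. b - a) ` disc n \<subseteq> ?I"
      proof
        fix z assume "z \<in> (\<lambda>b. b - a) ` disc n"
        then obtain b where b: "z = b - a" "b \<in> disc n" by blast
        have "a \<in> {-int n..int n} \<times> {-int n..int n}" "b \<in> {-int n..int n} \<times> {-int n..int n}"
          using disc_subset[of n] a b by blast+
        then show "z \<in> ?I" unfolding b(1) by (auto simp: mem_Times_iff)
      qed
    qed (use w0 in auto)
    also have "\<dots> \<le> 144 * L\<^sup>2" unfolding w_def L_def by (rule sum_inverse_norm2[OF n])
    finally show "(\<Sum>b\<in>disc n. H * w (b - a)) \<le> H * (144 * L\<^sup>2)"
      unfolding sum_distrib_left[symmetric] using H0 by (intro mult_left_mono)
  qed
  also have "\<dots> = real (card (disc n)) * (H * (144 * L\<^sup>2))" by simp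
  also have "\<dots> \<le> (9 * (real n)\<^sup>2) * (H * (144 * L\<^sup>2))"
    using n H0 by (intro mult_right_mono card_disc_le) auto
  \<comment> \<open>40176 = 9 * 144 * 31.\<close>
  also have "\<dots> = 40176 * exp (82 * pi * \<alpha>) * L ^ 3 * ((real n)\<^sup>2 * real n powr (rho2 \<alpha> \<beta> - 2))"
    by (simp add: H_def power2_eq_square power3_eq_cube)
  also have "(real n)\<^sup>2 * real n powr (rho2 \<alpha> \<beta> - 2) = real n powr rho2 \<alpha> \<beta>"
    using n by (simp add: powr_diff)
  finally show ?thesis by (simp add: L_def)
qed

section \<open>Lower bound for the expectation\<close>

text \<open>To leading order, with x = c L: d = \<gamma> x, B = (1 - \<gamma>) x, s = 1 / (\<gamma>
  (2 - \<gamma>) x), r = (1 - \<gamma>) s, and the loss per visit is s - r = 1 / ((2 - \<gamma>) x).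
  The gap 28 separates the kernel bounds c L - 14 and c L + 14, and makes A + B + 28 equal to 2 x -
  d.\<close>

lemma two_point_rates:
  fixes c L \<gamma> d :: real
  assumes c: "0 < c" and \<gamma>: "0 < \<gamma>" "\<gamma> < 1" and L: "3584 \<le> c * \<gamma> * L" "56 \<le> c * (1 - \<gamma>) * L" "0 < L"
    and d: "c * \<gamma> * L - 14 \<le> d" "d \<le> c * \<gamma> * L + 14"
  defines "A \<equiv> c * L - 14"
  defines "B \<equiv> A - d"
  defines "s \<equiv> (A + 28) / (d * (A + B + 28))" and "r \<equiv> B / (d * (A + B + 28))"
  shows "0 < d" "0 < B" "s * A \<le> 8 / \<gamma>" "s \<le> 16 / (\<gamma> * (c * L))" "(1 - \<gamma>) / (8 * (c * L)) \<le> r" "r \<le> s"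
    "1 / (2 * (c * L)) \<le> s - r" "s - r < 1"
    "(s - r) / (1 - (s - r)) \<le> (1 + 56 / (c * \<gamma> * L)) / (c * (2 - \<gamma>) * L - 16)"
proof -
  define x where "x = c * L"
  have x: "3584 \<le> \<gamma> * x" "56 \<le> x - \<gamma> * x" "\<gamma> * x - 14 \<le> d" "d \<le> \<gamma> * x + 14"
    using L d by (auto simp: x_def algebra_simps)
  have gx: "\<gamma> * x \<le> 1 * x" using \<gamma> x c L by (intro mult_right_mono) (auto simp: x_def)
  have x0: "3584 \<le> x" using x gx by simp
  have A: "A = x - 14" "x / 2 \<le> A" "A \<le> x" "A + 28 \<le> 2 * x" using x0 unfolding A_def x_def[symmetric] by auto
  have D: "A + B + 28 = 2 * x - d" by (simp add: B_def A)
  have d1: "\<gamma> * x / 2 \<le> d" "d \<le> x" using x by linarith+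
  show d0: "0 < d" using d1 x by linarith
  have "(x - g) / 2 \<le> x - 14 - d" if "56 \<le> x - g" "d \<le> g + 14" for g
    using that by (simp add: field_simps)
  from this[OF x(2,4)] have "(x - \<gamma> * x) / 2 \<le> B" unfolding B_def A(1) .
  then have B1: "(1 - \<gamma>) * x / 2 \<le> B" by (simp only: left_diff_distrib mult_1)
  have "0 < (1 - \<gamma>) * x / 2" using \<gamma> x0 by simp
  then show B: "0 < B" using B1 by linarith
  have E: "x / 2 \<le> 2 * x - d" "2 * x - d \<le> 2 * x" "0 < 2 * x - d" using d1 d0 x0 by linarith+
  have den: "0 < d * (2 * x - d)" using d0 E by simp
  have den_ge: "\<gamma> * x\<^sup>2 / 4 \<le> d * (2 * x - d)"
  proof -
    have "(\<gamma> * x / 2) * (x / 2) \<le> d * (2 * x - d)" using d1 E x x0 d0 by (intro mult_mono) auto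
    then show ?thesis by (simp add: power2_eq_square)
  qed
  have gx2: "0 < \<gamma> * x\<^sup>2 / 4" using \<gamma> x0 by simp
  have s: "s = (A + 28) / (d * (2 * x - d))" "r = B / (d * (2 * x - d))" by (simp_all add: s_def r_def D)
  have "s * A = (A + 28) * A / (d * (2 * x - d))" by (simp add: s)
  also have "\<dots> \<le> (2 * x) * x / (d * (2 * x - d))" using A x0 den by (intro divide_right_mono mult_mono) auto
  also have "\<dots> \<le> (2 * x) * x / (\<gamma> * x\<^sup>2 / 4)" using x0 den den_ge gx2 by (intro divide_left_mono) auto
  also have "\<dots> = 8 / \<gamma>" using x0 by (simp add: power2_eq_square)
  finally show sA: "s * A \<le> 8 / \<gamma>" .
  have "0 < A" using A x0 by linarith
  from pos_le_divide_eq[OF this, THEN iffD2, OF sA] have "s \<le> (8 / \<gamma>) / A" .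
  also have "\<dots> \<le> (8 / \<gamma>) / (x / 2)" using A x0 \<gamma> by (intro divide_left_mono) auto
  also have "\<dots> = 16 / (\<gamma> * x)" by simp
  finally show s16: "s \<le> 16 / (\<gamma> * (c * L))" by (simp add: x_def)
  have "(1 - \<gamma>) / (8 * x) = ((1 - \<gamma>) * x / 2) / (2 * x * (2 * x))" using x0 by (simp add: field_simps power2_eq_square)
  also have "\<dots> \<le> B / (d * (2 * x - d))"
    using B B1 den d1 E x0 d0 \<gamma> by (intro frac_le mult_mono) auto
  finally show "(1 - \<gamma>) / (8 * (c * L)) \<le> r" by (simp add: s x_def)
  show "r \<le> s" unfolding s using den d0 by (intro divide_right_mono) (auto simp: B_def)
  have sr: "s - r = (1 + 28 / d) / (2 * x - d)"
  proof -
    have "s - r = (d + 28) / (d * (2 * x - d))" unfolding s by (simp add: B_def flip: diff_divide_distrib)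
    also have "d + 28 = d * (1 + 28 / d)" using d0 by (simp add: distrib_left)
    finally show ?thesis using d0 by simp
  qed
  have "1 / (2 * x) \<le> (1 + 28 / d) / (2 * x - d)" using E d0 x0 by (intro frac_le) auto
  then show "1 / (2 * (c * L)) \<le> s - r" by (simp add: sr x_def)
  have d28: "28 / d \<le> 56 / (\<gamma> * x)"
  proof -
    have "28 / d \<le> 28 / (\<gamma> * x / 2)" using d1 x d0 by (intro divide_left_mono) auto
    then show ?thesis by simp
  qed
  have "56 / (\<gamma> * x) \<le> 1" using x by (simp add: divide_le_eq_1)
  then have d28': "28 / d \<le> 1" using d28 by linarith
  have E': "2 * x - \<gamma> * x - 16 \<le> 2 * x - d - (1 + 28 / d)" using x d28' by linarith
  have E0: "0 < 2 * x - \<gamma> * x - 16" using x x0 gx by linarith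
  have lt: "1 + 28 / d < 2 * x - d" using E' E0 by linarith
  then show "s - r < 1" unfolding sr using E by simp
  have "(s - r) / (1 - (s - r)) = (1 + 28 / d) / (2 * x - d - (1 + 28 / d))"
  proof -
    have "1 - (s - r) = (2 * x - d - (1 + 28 / d)) / (2 * x - d)" unfolding sr using E by (simp add: diff_divide_distrib)
    then show ?thesis unfolding sr using E by simp
  qed
  also have "\<dots> \<le> (1 + 56 / (\<gamma> * x)) / (2 * x - \<gamma> * x - 16)"
    using d28 E' E0 x by (intro frac_le) auto
  finally show "(s - r) / (1 - (s - r)) \<le> (1 + 56 / (c * \<gamma> * L)) / (c * (2 - \<gamma>) * L - 16)"
    by (simp add: x_def algebra_simps)
qed

lemma one_minus_power_ge:
  fixes t :: real
  assumes "0 \<le> t" "t < 1"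
  shows "exp (- real m * (t / (1 - t))) \<le> (1 - t) ^ m"
proof -
  have "1 / (1 - t) = 1 + t / (1 - t)" using assms by (simp add: field_simps)
  also have "\<dots> \<le> exp (t / (1 - t))" by (rule exp_ge_add_one_self)
  finally have "inverse (exp (t / (1 - t))) \<le> inverse (1 / (1 - t))"
    using assms by (intro le_imp_inverse_le) auto
  then have "exp (- (t / (1 - t))) \<le> 1 - t" by (simp add: exp_minus)
  then have "exp (- (t / (1 - t))) ^ m \<le> (1 - t) ^ m" by (intro power_mono) auto
  then show ?thesis by (simp add: exp_of_nat_mult[symmetric])
qed

text \<open>Bounds the exponent of (1 - t)^(2 k) for t = s - r: twice a bound for
  \<open>level\<close>, times the bound of \<open>two_point_rates\<close> for t / (1 - t).\<close>

definition decay_rate :: "real \<Rightarrow> real \<Rightarrow> real \<Rightarrow> real" where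
  "decay_rate \<alpha> \<gamma> L = 2 * (4 * \<alpha> / pi * L\<^sup>2 + 1) * ((1 + 56 / (2/pi * \<gamma> * L)) / (2/pi * (2 - \<gamma>) * L - 16))"

text \<open>\<open>pair_prob_ge\<close> with A = c L - 14 and C = 28. Points within n/2 of the
  origin are at least n/2 away from the boundary sites, which gives the lower bound \<open>A\<close>
  there; pot a = c (1 - \<delta>) L + O(1) makes the value of \<open>fa\<close> and
  \<open>fb\<close> at 0 at least \<delta>/4.\<close>

lemma pair_prob_ge_decay:
  fixes n :: nat and \<alpha> \<gamma> \<delta> :: real
  defines "L \<equiv> ln (real n)" and "c \<equiv> 2/pi"
  assumes \<alpha>: "0 < \<alpha>" "\<alpha> < 1" and \<gamma>: "0 < \<gamma>" "\<gamma> < 1" and \<delta>: "0 < \<delta>" "\<delta> < 1"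
    and n: "1 \<le> n" and L: "3584 \<le> c * \<gamma> * \<delta> * L" "56 \<le> c * (1 - \<gamma>) * L"
    and ab: "a \<in> disc n" "b \<in> disc n"
    and far: "zdist a (0,0) \<le> real n / 2" "zdist b (0,0) \<le> real n / 2"
    and pot: "\<bar>pot a - c * (1 - \<delta>) * L\<bar> \<le> 14" "\<bar>pot b - c * (1 - \<delta>) * L\<bar> \<le> 14" "\<bar>pot (a - b) - c * \<gamma> * L\<bar> \<le> 14"
  shows "\<gamma> * (1 - \<gamma>) * \<delta> * pi / 6144 / L ^ 3 * exp (- decay_rate \<alpha> \<gamma> L) \<le> pair_prob n (level \<alpha> n) a b"
proof -
  define A where "A = c * L - 14"
  define d where "d = pot (a - b)"
  define B where "B = A - d"
  define s where "s = (A + 28) / (d * (A + B + 28))"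
  define r where "r = B / (d * (A + B + 28))"
  have c: "0 < c" "c < 1" using pi_gt3 by (auto simp: c_def)
  have L0: "0 < L"
  proof (rule ccontr)
    assume "\<not> 0 < L"
    then have "c * \<gamma> * \<delta> * L \<le> 0" using c \<gamma> \<delta> by (intro mult_nonneg_nonpos) auto
    then show False using L by simp
  qed
  have "c * \<gamma> * L * \<delta> \<le> c * \<gamma> * L * 1" using c \<gamma> \<delta> L0 by (intro mult_left_mono) auto
  then have L1: "3584 \<le> c * \<gamma> * L" using L by (simp add: mult_ac)
  have "c * \<gamma> * L \<le> c * 1 * L" using c \<gamma> L0 by (intro mult_left_mono mult_right_mono) auto
  then have cL: "3584 \<le> c * L" using L1 by simp
  have "c * L \<le> 1 * L" using c L0 by (intro mult_right_mono) auto
  then have L2: "3584 \<le> L" using cL by simp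
  have dd: "c * \<gamma> * L - 14 \<le> d" "d \<le> c * \<gamma> * L + 14" using pot(3) unfolding d_def by linarith+
  note rates = two_point_rates[OF c(1) \<gamma> L1 L(2) L0 dd, folded A_def B_def s_def r_def,
      folded A_def, folded B_def, folded s_def r_def]
  have "a \<noteq> b"
  proof
    assume "a = b"
    then have "d = 0" using pot_0 by (simp add: d_def zero_prod_def)
    then show False using rates(1) by simp
  qed
  have k1: "1 \<le> level \<alpha> n"
  proof -
    have "0 < 4 * \<alpha> / pi * L\<^sup>2" using \<alpha> L0 by simp
    then show ?thesis unfolding L_def by linarith
  qed
  have k2: "real (level \<alpha> n) \<le> 4 * \<alpha> / pi * L\<^sup>2 + 1"
  proof -
    have "0 \<le> 4 * \<alpha> / pi * L\<^sup>2" using \<alpha> by simp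
    then show ?thesis unfolding L_def by linarith
  qed
  have k3: "real (level \<alpha> n) \<le> 3 * L\<^sup>2"
  proof -
    have "4 * \<alpha> / pi \<le> 2" using \<alpha> pi_gt3 by (simp add: field_simps)
    then have "4 * \<alpha> / pi * L\<^sup>2 \<le> 2 * L\<^sup>2" by (intro mult_right_mono) auto
    moreover have "1 \<le> L\<^sup>2" using L2 by (simp add: one_le_power)
    ultimately show ?thesis using k2 by linarith
  qed
  have low: "A \<le> pot (z - x)" if z: "z \<in> disc_nb n" "z \<notin> disc n" and x: "zdist x (0,0) \<le> real n / 2" for z x
  proof -
    have "real n < zdist z (0,0)" using z(2) zdist_commute[of z] by (simp add: zdisc_def)
    also have "\<dots> \<le> zdist z x + zdist x (0,0)" by (rule zdist_triangle)
    finally have zx: "real n / 2 \<le> zdist z x" using x by linarith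
    have "z \<noteq> x" using zx n by (auto simp: zdist_def)
    then have "\<bar>pot (z - x) - c * ln (zdist z x)\<bar> \<le> 12" unfolding c_def by (rule pot_diff_bounds)
    moreover have "c * (L - 1) \<le> c * ln (zdist z x)"
    proof (rule mult_left_mono)
      have "ln (real n / 2) \<le> ln (zdist z x)" using zx n by (subst ln_le_cancel_iff) auto
      moreover have "ln (real n / 2) = L - ln 2" using n by (simp add: L_def ln_div)
      ultimately show "L - 1 \<le> ln (zdist z x)" using ln_2_less_1 by linarith
    qed (use c in simp)
    moreover have "c * (L - 1) = c * L - c" by (simp add: algebra_simps)
    ultimately show ?thesis using c unfolding A_def by linarith
  qed
  have upp: "pot (z - x) \<le> A + 28" if "z \<in> disc_nb n" "x \<in> disc n" for z x
    using pot_disc_le[OF that n] by (simp add: A_def c_def L_def)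
  \<comment> \<open>The gain (s - r) c \<delta> L is at least \<delta>/2, and the errors 28 s + 28 r
    are at most 56 \<delta> / 224 = \<delta>/4; this is the origin of 3584 = 16 * 224.\<close>
  define \<phi> where "\<phi> = \<delta> / 4"
  have s0: "0 < r" "0 \<le> s"
  proof -
    have "0 < (1 - \<gamma>) / (8 * (c * L))" using \<gamma> c L0 by simp
    then show "0 < r" using rates(5) by linarith
    then show "0 \<le> s" using rates(6) by linarith
  qed
  have s16: "s \<le> \<delta> / 224" "s \<le> 1 / 2"
  proof -
    have "16 / (\<gamma> * (c * L)) \<le> \<delta> / 224" using L(1) \<gamma> c L0 by (simp add: field_simps)
    then show "s \<le> \<delta> / 224" using rates(4) by linarith
    then show "s \<le> 1 / 2" using \<delta> by linarith
  qed
  have phi: "\<phi> \<le> s * (A - pot x) - r * (A + 28 - pot y)"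
    if "\<bar>pot x - c * (1 - \<delta>) * L\<bar> \<le> 14" "\<bar>pot y - c * (1 - \<delta>) * L\<bar> \<le> 14" for x y
  proof -
    define e where "e = c * \<delta> * L"
    have e: "c * (1 - \<delta>) * L = c * L - e" by (simp add: e_def algebra_simps)
    have "s * (e - 28) \<le> s * (A - pot x)"
      using that(1) s0 unfolding e A_def by (intro mult_left_mono) auto
    moreover have "r * (A + 28 - pot y) \<le> r * (e + 28)"
      using that(2) s0 unfolding e A_def by (intro mult_left_mono) auto
    moreover have "\<delta> / 2 \<le> (s - r) * e"
    proof -
      have "1 / (2 * (c * L)) * e \<le> (s - r) * e" using rates(7) c \<delta> L0 by (intro mult_right_mono) (auto simp: e_def)
      moreover have "1 / (2 * (c * L)) * e = \<delta> / 2" using c L0 by (simp add: e_def)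
      ultimately show ?thesis by (simp only:)
    qed
    moreover have "s * (e - 28) - r * (e + 28) = (s - r) * e - 28 * s - 28 * r" by (simp add: algebra_simps)
    ultimately show ?thesis using rates(6) s16 unfolding \<phi>_def by linarith
  qed
  have s1: "s \<le> 1" using s16(2) by simp
  have main: "1 / (s * A) * (1 - s) * r * ((1 - s + r) ^ (2 * (level \<alpha> n - 1)) / real (level \<alpha> n)) * \<phi> \<le> pair_prob n (level \<alpha> n) a b"
    unfolding s_def r_def B_def d_def
  proof (rule pair_prob_ge)
    show "(A + 28) / (pot (a - b) * (A + (A - pot (a - b)) + 28)) \<le> 1"
      using s1 unfolding s_def B_def d_def .
    show "0 < pot (a - b)" "0 < A - pot (a - b)" using rates(1,2) by (simp_all add: d_def B_def)
    show "\<phi> \<le> (A + 28) / (pot (a - b) * (A + (A - pot (a - b)) + 28)) * (A - pot a)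
       - (A - pot (a - b)) / (pot (a - b) * (A + (A - pot (a - b)) + 28)) * (A + 28 - pot b)"
      "\<phi> \<le> (A + 28) / (pot (a - b) * (A + (A - pot (a - b)) + 28)) * (A - pot b)
       - (A - pot (a - b)) / (pot (a - b) * (A + (A - pot (a - b)) + 28)) * (A + 28 - pot a)"
      using phi[OF pot(1,2)] phi[OF pot(2,1)] unfolding s_def r_def B_def d_def .
    show "0 \<le> \<phi>" using \<delta> by (simp add: \<phi>_def)
  qed (use ab \<open>a \<noteq> b\<close> k1 low upp far in auto)
  define t where "t = s - r"
  have t: "0 \<le> t" "t < 1" using rates(6,8) by (auto simp: t_def)
  have pw: "exp (- decay_rate \<alpha> \<gamma> L) \<le> (1 - s + r) ^ (2 * (level \<alpha> n - 1))"
  proof -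
    have tt: "t / (1 - t) \<le> (1 + 56 / (c * \<gamma> * L)) / (c * (2 - \<gamma>) * L - 16)" "0 \<le> t / (1 - t)"
      using rates(9) t by (auto simp: t_def)
    have "real (2 * (level \<alpha> n - 1)) * (t / (1 - t)) \<le> 2 * (4 * \<alpha> / pi * L\<^sup>2 + 1) * ((1 + 56 / (c * \<gamma> * L)) / (c * (2 - \<gamma>) * L - 16))"
      using tt k1 k2 by (intro mult_mono) (auto simp: of_nat_diff)
    then have "exp (- decay_rate \<alpha> \<gamma> L) \<le> exp (- real (2 * (level \<alpha> n - 1)) * (t / (1 - t)))"
      unfolding decay_rate_def c_def by simp
    also have "\<dots> \<le> (1 - t) ^ (2 * (level \<alpha> n - 1))" by (rule one_minus_power_ge[OF t])
    finally show ?thesis by (simp add: t_def algebra_simps)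
  qed
  have A0: "0 < A" using cL by (simp add: A_def)
  have sA0: "0 < s * A" using s0 rates(6) A0 by (intro mult_pos_pos) auto
  \<comment> \<open>One power of 1/L comes from \<open>r\<close> and two come from 1 /
    \<open>level\<close>; all are negligible against powers of n.\<close>
  have "\<gamma> * (1 - \<gamma>) * \<delta> * pi / 6144 / L ^ 3 * exp (- decay_rate \<alpha> \<gamma> L)
    = (\<gamma> / 8) * (1 / 2) * ((1 - \<gamma>) / (8 * (c * L))) * (exp (- decay_rate \<alpha> \<gamma> L) / (3 * L\<^sup>2)) * \<phi> * (1 / 2)"
    using L0 by (simp add: \<phi>_def c_def power2_eq_square power3_eq_cube mult_ac)
  also have "\<dots> \<le> 1 / (s * A) * (1 - s) * r * ((1 - s + r) ^ (2 * (level \<alpha> n - 1)) / real (level \<alpha> n)) * \<phi> * 1"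
  proof -
    have "1 / (8 / \<gamma>) \<le> 1 / (s * A)" using rates(3) sA0 \<gamma> by (intro divide_left_mono) auto
    then have f1: "\<gamma> / 8 \<le> 1 / (s * A)" by simp
    have f2: "1 / 2 \<le> 1 - s" using s16 by simp
    have f4: "exp (- decay_rate \<alpha> \<gamma> L) / (3 * L\<^sup>2) \<le> (1 - s + r) ^ (2 * (level \<alpha> n - 1)) / real (level \<alpha> n)"
    proof (rule frac_le[OF order_trans[OF exp_ge_zero pw] pw _ k3])
      show "0 < real (level \<alpha> n)" using k1 by linarith
    qed
    have "0 \<le> (1 - \<gamma>) / (8 * (c * L))" using \<gamma> c L0 by simp
    moreover have "0 \<le> exp (- decay_rate \<alpha> \<gamma> L) / (3 * L\<^sup>2)" by simp
    moreover have "0 \<le> 1 / (s * A)" "0 \<le> 1 - s" "0 \<le> \<phi>" "0 \<le> r" "0 \<le> \<gamma> / 8"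
      using sA0 s1 s0 \<delta> \<gamma> by (auto simp: \<phi>_def)
    moreover note f1 f2 rates(5) f4
    ultimately show ?thesis by (intro mult_mono mult_nonneg_nonneg) simp_all
  qed
  also have "\<dots> \<le> pair_prob n (level \<alpha> n) a b" using main by simp
  finally show ?thesis .
qed

text \<open>A distance known up to a factor 8 shifts the logarithmic term by at most (2/pi) * 3
  \<le> 2, so the error grows from 12 to 14.\<close>

lemma pot_near:
  assumes z: "z \<noteq> (0,0)" and v: "0 < v" "v / 8 \<le> zdist z (0,0)" "zdist z (0,0) \<le> 8 * v"
  shows "\<bar>pot z - 2/pi * ln v\<bar> \<le> 14"
proof -
  define l where "l = ln (zdist z (0,0))"
  have d: "0 < zdist z (0,0)" using v by linarith
  have "ln (2 ^ 3 :: real) = 3 * ln 2" by (subst ln_realpow) auto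
  then have l8: "ln 8 \<le> (3::real)" using ln_2_less_1 by simp
  have "ln (v / 8) \<le> l" unfolding l_def using v d by (subst ln_le_cancel_iff) auto
  moreover have "l \<le> ln (8 * v)" unfolding l_def using v d by (subst ln_le_cancel_iff) auto
  ultimately have "\<bar>l - ln v\<bar> \<le> 3" using v l8 by (simp add: ln_div ln_mult abs_le_iff)
  then have "2/pi * \<bar>l - ln v\<bar> \<le> 2/pi * 3" by (intro mult_left_mono) auto
  also have "\<dots> \<le> 2" using pi_gt3 by (simp add: field_simps)
  also have "2/pi * \<bar>l - ln v\<bar> = \<bar>2/pi * (l - ln v)\<bar>" by (subst abs_mult) simp
  finally have "\<bar>2/pi * l - 2/pi * ln v\<bar> \<le> 2" by (simp only: right_diff_distrib)
  moreover have "\<bar>pot z - 2/pi * l\<bar> \<le> 12" unfolding l_def by (rule pot_asymp[OF z])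
  ultimately show ?thesis by linarith
qed

lemma zdist_box:
  assumes "fst z \<in> {int p..int q}" "snd z \<in> {int p..int q}"
  shows "real p \<le> zdist z (0,0)" "zdist z (0,0) \<le> 2 * real q"
proof -
  obtain x y where z: "z = (x,y)" by fastforce
  have "int p \<le> max \<bar>x\<bar> \<bar>y\<bar>" "max \<bar>x\<bar> \<bar>y\<bar> \<le> int q" using assms z by auto
  then have "real p \<le> of_int (max \<bar>x\<bar> \<bar>y\<bar>)" "of_int (max \<bar>x\<bar> \<bar>y\<bar>) \<le> real q" by linarith+
  then show "real p \<le> zdist z (0,0)" "zdist z (0,0) \<le> 2 * real q"
    using zdist_0_max[of x y] unfolding z by linarith+
qed

text \<open>The pairs are (a, a + z) with \<open>a\<close> in a box of scale n^(1 - \<delta>) and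
  \<open>z\<close> in one of scale n^\<gamma>; all satisfy the same lower bound. Both boxes lie in
  the positive quadrant, so a + z cannot come close to 0.\<close>

lemma expectation_lower:
  fixes \<alpha> \<beta> \<gamma> \<delta> :: real
  assumes \<alpha>: "0 < \<alpha>" "\<alpha> < 1" and \<gamma>: "0 < \<gamma>" "\<gamma> \<le> \<beta>" "\<beta> < 1" and \<delta>: "0 < \<delta>" "\<delta> \<le> 1 - \<gamma>"
    and n: "1 \<le> n" "12 \<le> real n powr \<delta>" "4 \<le> real n powr \<gamma>"
    and L: "3584 \<le> 2/pi * \<gamma> * \<delta> * ln (real n)" "56 \<le> 2/pi * (1 - \<gamma>) * ln (real n)"
  shows "\<gamma> * (1 - \<gamma>) * \<delta> * pi / 98304 / (ln (real n)) ^ 3 * exp (- decay_rate \<alpha> \<gamma> (ln (real n)))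
     * real n powr (2 + 2 * \<gamma> - 2 * \<delta>) \<le> integral\<^sup>L srw_space (\<lambda>\<omega>. real (close_pairs n \<alpha> \<beta> \<omega>))"
proof -
  define y where "y = real n powr (1 - \<delta>)"
  define w where "w = real n powr \<gamma>"
  define m where "m = nat \<lfloor>y\<rfloor>"
  \<comment> \<open>The quarter gives |z| \<le> 4 l \<le> n^\<gamma>, and n^\<gamma> \<ge> 4 gives l
    \<ge> 1.\<close>
  define l where "l = nat \<lfloor>w / 4\<rfloor>"
  define H where "H = \<gamma> * (1 - \<gamma>) * \<delta> * pi / 6144 / (ln (real n)) ^ 3 * exp (- decay_rate \<alpha> \<gamma> (ln (real n)))"
  have L0: "0 < ln (real n)"
  proof -
    have "0 \<le> ln (real n)" using n by simp
    moreover have "ln (real n) \<noteq> 0" using L by auto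
    ultimately show ?thesis by linarith
  qed
  have H0: "0 \<le> H" unfolding H_def using \<gamma> \<delta> L0 by (intro mult_nonneg_nonneg divide_nonneg_nonneg) auto
  have wy: "w \<le> y" unfolding w_def y_def using n \<delta> by (intro powr_mono) auto
  have w4: "4 \<le> w" using n by (simp add: w_def)
  \<comment> \<open>Makes room for |a + z| \<le> 4 m + 4 l \<le> 5 y \<le> n / 2.\<close>
  have ny: "12 * y \<le> real n"
  proof -
    have "12 * y \<le> real n powr \<delta> * y" using n by (intro mult_right_mono) (auto simp: y_def)
    also have "\<dots> = real n" using n by (simp add: y_def flip: powr_add)
    finally show ?thesis .
  qed
  have m: "real m \<le> y" "y < real m + 1" "y / 2 \<le> real m" using w4 wy unfolding m_def by linarith+
  have l1: "1 \<le> l" using w4 unfolding l_def by linarith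
  have l: "real l \<le> w / 4" "w / 4 < real l + 1" using w4 unfolding l_def by linarith+
  have l8: "w / 8 \<le> real l" using l l1 by linarith
  have lny: "ln y = (1 - \<delta>) * ln (real n)" "ln w = \<gamma> * ln (real n)" using n by (simp_all add: y_def w_def ln_powr)
  let ?M = "{int m..int (2*m)} \<times> {int m..int (2*m)}" and ?Z = "{int l..int (2*l)} \<times> {int l..int (2*l)}"
  let ?Q = "{p. fst p \<in> disc n \<and> snd p \<in> disc n \<and> zdist (fst p) (snd p) \<le> real n powr \<beta>}"
  let ?f = "\<lambda>p::pt \<times> pt. (fst p, fst p + snd p)"
  have pt: "a \<in> disc n \<and> a + z \<in> disc n \<and> zdist a (a + z) \<le> real n powr \<beta> \<and> H \<le> pair_prob n (level \<alpha> n) a (a + z)"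
    if az: "a \<in> ?M" "z \<in> ?Z" for a z
  proof -
    let ?b = "a + z"
    have a1: "real m \<le> zdist a (0,0)" "zdist a (0,0) \<le> 2 * real (2*m)"
      using zdist_box[of a m "2*m"] az by (simp_all add: mem_Times_iff)
    have z1: "real l \<le> zdist z (0,0)" "zdist z (0,0) \<le> 2 * real (2*l)"
      using zdist_box[of z l "2*l"] az by (simp_all add: mem_Times_iff)
    have b1: "real m \<le> zdist ?b (0,0)" "zdist ?b (0,0) \<le> 2 * real (2*m + 2*l)"
      using zdist_box[of ?b m "2*m + 2*l"] az by (simp_all add: mem_Times_iff)
    have b2: "zdist ?b (0,0) \<le> 4 * real m + 4 * real l" using b1(2) by simp
    have ab: "a \<in> disc n" "?b \<in> disc n" "zdist a (0,0) \<le> real n / 2" "zdist ?b (0,0) \<le> real n / 2"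
      using a1 b1 m l l8 wy ny w4 zdist_commute[of "(0,0)"] unfolding zdisc_def by simp_all
    have zab: "zdist a ?b = zdist z (0,0)" unfolding zdist_commute[of a] by (simp add: zdist_def)
    have zw: "zdist z (0,0) \<le> w" using z1 l by simp
    have w\<beta>: "w \<le> real n powr \<beta>" unfolding w_def using n \<gamma> by (intro powr_mono) auto
    have nz: "a \<noteq> (0,0)" "?b \<noteq> (0,0)" "z \<noteq> (0,0)" "a - ?b = (- fst z, - snd z)"
      using az l1 m w4 wy by (auto simp: mem_Times_iff prod_eq_iff)
    have pz: "pot (a - ?b) = pot z" unfolding nz(4) using pot_uminus[of "fst z" "snd z"] by simp
    have "H \<le> pair_prob n (level \<alpha> n) a ?b"
      unfolding H_def
    proof (rule pair_prob_ge_decay)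
      have "\<bar>pot a - 2/pi * ln y\<bar> \<le> 14"
        using a1 m wy w4 nz(1) by (intro pot_near; (assumption | linarith))
      moreover have "\<bar>pot ?b - 2/pi * ln y\<bar> \<le> 14"
        using b1(1) b2 m l wy w4 nz(2) by (intro pot_near; (assumption | linarith))
      ultimately show "\<bar>pot a - 2/pi * (1 - \<delta>) * ln (real n)\<bar> \<le> 14" "\<bar>pot ?b - 2/pi * (1 - \<delta>) * ln (real n)\<bar> \<le> 14"
        unfolding lny by (simp_all only: mult.assoc)
      have "\<bar>pot z - 2/pi * ln w\<bar> \<le> 14" using z1 l l8 w4 nz(3) by (intro pot_near; (assumption | linarith))
      then show "\<bar>pot (a - ?b) - 2/pi * \<gamma> * ln (real n)\<bar> \<le> 14" unfolding lny pz by (simp only: mult.assoc)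
    qed (use \<alpha> \<gamma> \<delta> n L ab in auto)
    then show ?thesis using ab zab zw w\<beta> by auto
  qed
  have Q: "finite ?Q" by (rule finite_subset[of _ "disc n \<times> disc n"]) (auto simp: finite_disc)
  have inj: "inj_on ?f (?M \<times> ?Z)" by (auto simp: inj_on_def)
  have sub: "?f ` (?M \<times> ?Z) \<subseteq> ?Q"
  proof
    fix p assume "p \<in> ?f ` (?M \<times> ?Z)"
    then obtain a z where "p = (a, a + z)" "a \<in> ?M" "z \<in> ?Z" by auto
    then show "p \<in> ?Q" using pt[of a z] by simp
  qed
  have card: "real (card (?M \<times> ?Z)) = (real m + 1)\<^sup>2 * (real l + 1)\<^sup>2"
  proof -
    have "nat (int (2*k) - int k + 1) = k + 1" for k by simp
    then have "card {int k..int (2*k)} = k + 1" for k by simp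
    then show ?thesis by (simp add: card_cartesian_product power2_eq_square algebra_simps del: card_atLeastAtMost_int)
  qed
  have yw: "y\<^sup>2 * (w / 4)\<^sup>2 = real n powr (2 + 2 * \<gamma> - 2 * \<delta>) / 16"
  proof -
    have "y\<^sup>2 * w\<^sup>2 = real n powr (1 - \<delta>) * real n powr (1 - \<delta>) * (real n powr \<gamma> * real n powr \<gamma>)"
      by (simp add: y_def w_def power2_eq_square)
    also have "\<dots> = real n powr (2 + 2 * \<gamma> - 2 * \<delta>)" by (simp add: algebra_simps flip: powr_add)
    finally show ?thesis by (simp add: power_divide)
  qed
  have "H * (y\<^sup>2 * (w / 4)\<^sup>2) \<le> H * ((real m + 1)\<^sup>2 * (real l + 1)\<^sup>2)"
    using m l w4 wy H0 by (intro mult_left_mono mult_mono power_mono) auto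
  also have "\<dots> = (\<Sum>p\<in>?M \<times> ?Z. H)" unfolding card[symmetric] by (simp only: sum_constant mult.commute)
  also have "\<dots> \<le> (\<Sum>p\<in>?M \<times> ?Z. pair_prob n (level \<alpha> n) (fst (?f p)) (snd (?f p)))"
    using pt by (intro sum_mono) (simp add: mem_Times_iff)
  also have "\<dots> = (\<Sum>p\<in>?f ` (?M \<times> ?Z). pair_prob n (level \<alpha> n) (fst p) (snd p))"
    by (subst sum.reindex[OF inj]) (simp only: o_def)
  also have "\<dots> \<le> (\<Sum>p\<in>?Q. pair_prob n (level \<alpha> n) (fst p) (snd p))"
    by (rule sum_mono2[OF Q sub]) (simp add: pair_prob_def)
  also have "\<dots> = integral\<^sup>L srw_space (\<lambda>\<omega>. real (close_pairs n \<alpha> \<beta> \<omega>))"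
    by (rule integral_close_pairs[symmetric])
  finally show ?thesis unfolding yw H_def by (simp add: mult_ac)
qed

section \<open>Exponents in the limit\<close>

lemma ln_nat_at_top: "filterlim (\<lambda>n::nat. ln (real n)) at_top sequentially"
  by (rule filterlim_compose[OF ln_at_top filterlim_real_sequentially])

lemma decay_rate_tendsto:
  assumes "0 < \<gamma>" "\<gamma> < 1"
  shows "((\<lambda>L. decay_rate \<alpha> \<gamma> L / L) \<longlongrightarrow> 4 * \<alpha> / (2 - \<gamma>)) at_top"
proof -
  define c where "c = 2/pi"
  have c: "0 < c" by (simp add: c_def)
  have u: "((\<lambda>L::real. inverse L) \<longlongrightarrow> 0) at_top" by (rule tendsto_inverse_0_at_top) (rule filterlim_ident)
  have ne: "c * (2 - \<gamma>) - 16 * 0 \<noteq> 0" using c assms by simp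
  have "((\<lambda>L. 2 * (4 * \<alpha> / pi + (inverse L)\<^sup>2) * ((1 + 56 / (c * \<gamma>) * inverse L) / (c * (2 - \<gamma>) - 16 * inverse L)))
     \<longlongrightarrow> 2 * (4 * \<alpha> / pi + 0\<^sup>2) * ((1 + 56 / (c * \<gamma>) * 0) / (c * (2 - \<gamma>) - 16 * 0))) at_top"
    by (intro tendsto_intros u ne)
  also have "2 * (4 * \<alpha> / pi + 0\<^sup>2) * ((1 + 56 / (c * \<gamma>) * 0) / (c * (2 - \<gamma>) - 16 * 0)) = 4 * \<alpha> / (2 - \<gamma>)"
    using assms by (simp add: c_def field_simps)
  finally show ?thesis
  proof (rule Lim_transform_eventually)
    show "\<forall>\<^sub>F L in at_top. 2 * (4 * \<alpha> / pi + (inverse L)\<^sup>2) * ((1 + 56 / (c * \<gamma>) * inverse L) / (c * (2 - \<gamma>) - 16 * inverse L))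
      = decay_rate \<alpha> \<gamma> L / L"
      using eventually_gt_at_top[of 0]
    proof eventually_elim
      case (elim L)
      have d: "c * (2 - \<gamma>) * L - 16 = L * (c * (2 - \<gamma>) - 16 * inverse L)" using elim by (simp add: algebra_simps)
      have e: "4 * \<alpha> / pi * L\<^sup>2 + 1 = L\<^sup>2 * (4 * \<alpha> / pi + (inverse L)\<^sup>2)" using elim by (simp add: algebra_simps power2_eq_square)
      have f: "56 / (c * \<gamma> * L) = 56 / (c * \<gamma>) * inverse L" by (simp add: divide_inverse)
      show ?case unfolding decay_rate_def c_def[symmetric] d e f using elim by (simp add: power2_eq_square)
    qed
  qed
qed

lemma log_correction_tendsto: "(\<lambda>n::nat. (K + k * ln (ln (real n))) / ln (real n)) \<longlonglongrightarrow> 0"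
proof -
  have "((\<lambda>L::real. K * inverse L + k * (ln L / L)) \<longlongrightarrow> K * 0 + k * 0) at_top"
    by (intro tendsto_intros ln_x_over_x_tendsto_0 tendsto_inverse_0_at_top filterlim_ident)
  from filterlim_compose[OF this ln_nat_at_top] show ?thesis
    by (simp add: add_divide_distrib divide_inverse algebra_simps)
qed

text \<open>The second branch is the first formula at \<beta> = 2 - sqrt (2 \<alpha>), because 4
  \<alpha> / sqrt (2 \<alpha>) = 2 sqrt (2 \<alpha>). So \<open>rho2\<close> is the exponent at the
  scale used in the lower bound.\<close>

lemma rho2_eq:
  assumes "0 < \<alpha>"
  shows "rho2 \<alpha> \<beta> = 2 + 2 * min \<beta> (2 - sqrt (2 * \<alpha>)) - 4 * \<alpha> / (2 - min \<beta> (2 - sqrt (2 * \<alpha>)))"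
proof -
  have "4 * \<alpha> / sqrt (2 * \<alpha>) = 2 * sqrt (2 * \<alpha>)"
    using assms by (simp add: field_simps)
  then show ?thesis by (auto simp: rho2_def min_def)
qed

theorem theorem2p2:
  fixes \<alpha> \<beta> :: real
  assumes "0 < \<alpha>" "\<alpha> < 1" "0 < \<beta>" "\<beta> < 1"
  shows "(\<lambda>n::nat. ln (integral\<^sup>L srw_space (\<lambda>\<omega>. real (close_pairs n \<alpha> \<beta> \<omega>))) / ln (real n))
           \<longlonglongrightarrow> rho2 \<alpha> \<beta>"
proof (rule tendstoI)
  fix \<epsilon> :: real assume \<epsilon>: "0 < \<epsilon>"
  define \<gamma> where "\<gamma> = min \<beta> (2 - sqrt (2 * \<alpha>))"
  define R where "R = rho2 \<alpha> \<beta>"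
  define E where "E n = integral\<^sup>L srw_space (\<lambda>\<omega>. real (close_pairs n \<alpha> \<beta> \<omega>))" for n
  have R: "R = 2 + 2 * \<gamma> - 4 * \<alpha> / (2 - \<gamma>)" unfolding R_def \<gamma>_def by (rule rho2_eq[OF assms(1)])
  \<comment> \<open>Gives \<gamma> > 0, so the optimal distance n^\<gamma> grows with n.\<close>
  have "sqrt (2 * \<alpha>) < sqrt (2\<^sup>2)" using assms by (subst real_sqrt_less_iff) auto
  then have \<gamma>: "0 < \<gamma>" "\<gamma> \<le> \<beta>" "\<gamma> < 1" using assms by (auto simp: \<gamma>_def)
  \<comment> \<open>The factor n^(- 2 \<delta>) costs at most \<epsilon>/2 in the exponent; \<delta>
    \<le> 1 - \<gamma> keeps the distance n^\<gamma> within a pair below its distance n^(1 -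
    \<delta>) from 0.\<close>
  define \<delta> where "\<delta> = min (\<epsilon> / 4) (1 - \<gamma>)"
  have \<delta>: "0 < \<delta>" "\<delta> \<le> 1 - \<gamma>" "\<delta> \<le> \<epsilon> / 4"
    using \<gamma>(3) \<epsilon> min.cobounded1[of "\<epsilon> / 4" "1 - \<gamma>"] by (simp_all only: \<delta>_def min.cobounded2)
  define K1 where "K1 = 40176 * exp (82 * pi * \<alpha>)"
  define K2 where "K2 = \<gamma> * (1 - \<gamma>) * \<delta> * pi / 98304"
  have K: "0 < K1" "0 < K2" using \<gamma> \<delta> by (auto simp: K1_def K2_def)
  have mult_top: "filterlim (\<lambda>n. x * ln (real n)) at_top sequentially" if "0 < x" for x :: real
    by (rule filterlim_tendsto_pos_mult_at_top[OF tendsto_const that ln_nat_at_top])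
  have powr_top: "filterlim (\<lambda>n. real n powr x) at_top sequentially" if "0 < x" for x :: real
  proof (rule filterlim_cong[THEN iffD1, OF refl refl _ filterlim_compose[OF exp_at_top mult_top[OF that]]])
    show "\<forall>\<^sub>F n in sequentially. exp (x * ln (real n)) = real n powr x"
      using eventually_gt_at_top[of 0] by eventually_elim (simp add: powr_def)
  qed
  have ev: "\<forall>\<^sub>F n in sequentially. 3 \<le> n \<and> 12 \<le> real n powr \<delta> \<and> 4 \<le> real n powr \<gamma>
      \<and> 3584 \<le> 2/pi * \<gamma> * \<delta> * ln (real n) \<and> 56 \<le> 2/pi * (1 - \<gamma>) * ln (real n)"
  proof (intro eventually_conj)
    show "\<forall>\<^sub>F n in sequentially. 12 \<le> real n powr \<delta>" "\<forall>\<^sub>F n in sequentially. 4 \<le> real n powr \<gamma>"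
      using powr_top \<gamma> \<delta> by (auto simp: filterlim_at_top)
    have "0 < 2/pi * \<gamma> * \<delta>" "0 < 2/pi * (1 - \<gamma>)" using \<gamma> \<delta> by auto
    from this[THEN mult_top]
    show "\<forall>\<^sub>F n in sequentially. 3584 \<le> 2/pi * \<gamma> * \<delta> * ln (real n)" "\<forall>\<^sub>F n in sequentially. 56 \<le> 2/pi * (1 - \<gamma>) * ln (real n)"
      unfolding filterlim_at_top by blast+
  qed (rule eventually_ge_at_top)
  have up: "\<forall>\<^sub>F n in sequentially. R + (ln K1 + 3 * ln (ln (real n))) / ln (real n) < R + \<epsilon>"
    using tendsto_add[OF tendsto_const log_correction_tendsto] \<epsilon> by (rule_tac order_tendstoD(2)[where y = "R + 0"]) auto
  have low: "\<forall>\<^sub>F n in sequentially. R - \<epsilon> < (ln K2 + (-3) * ln (ln (real n))) / ln (real n)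
      - decay_rate \<alpha> \<gamma> (ln (real n)) / ln (real n) + (2 + 2 * \<gamma> - 2 * \<delta>)"
  proof (rule order_tendstoD(1))
    show "(\<lambda>n. (ln K2 + (-3) * ln (ln (real n))) / ln (real n) - decay_rate \<alpha> \<gamma> (ln (real n)) / ln (real n) + (2 + 2 * \<gamma> - 2 * \<delta>))
      \<longlonglongrightarrow> 0 - 4 * \<alpha> / (2 - \<gamma>) + (2 + 2 * \<gamma> - 2 * \<delta>)"
      by (intro tendsto_intros log_correction_tendsto filterlim_compose[OF decay_rate_tendsto[OF \<gamma>(1,3)] ln_nat_at_top])
    show "R - \<epsilon> < 0 - 4 * \<alpha> / (2 - \<gamma>) + (2 + 2 * \<gamma> - 2 * \<delta>)" using R \<delta> \<epsilon> by linarith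
  qed
  have "\<forall>\<^sub>F n in sequentially. dist (ln (E n) / ln (real n)) R < \<epsilon>"
    using ev up low
  proof eventually_elim
    case (elim n)
    define L where "L = ln (real n)"
    have n: "3 \<le> n" using elim by blast
    have L: "1 \<le> L" unfolding L_def using n exp_le by (subst ln_ge_iff) auto
    have lo: "K2 / L ^ 3 * exp (- decay_rate \<alpha> \<gamma> L) * real n powr (2 + 2 * \<gamma> - 2 * \<delta>) \<le> E n"
      unfolding K2_def L_def E_def
      by (rule expectation_lower) (use assms \<gamma> \<delta> elim in auto)
    have hi: "E n \<le> K1 * L ^ 3 * real n powr R"
      unfolding K1_def L_def E_def R_def by (rule expectation_upper) (use assms n in auto)
    have lo0: "0 < K2 / L ^ 3 * exp (- decay_rate \<alpha> \<gamma> L) * real n powr (2 + 2 * \<gamma> - 2 * \<delta>)"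
      using K L n by (intro mult_pos_pos divide_pos_pos) auto
    \<comment> \<open>Positivity comes from the lower bound and must precede logarithms, since
      \<open>ln 0\<close> is a default value.\<close>
    have E0: "0 < E n" using lo lo0 by linarith
    have "ln (E n) \<le> ln (K1 * L ^ 3 * real n powr R)"
      using hi E0 by (subst ln_le_cancel_iff) auto
    also have "\<dots> = (ln K1 + 3 * ln L) + R * L"
      using K L n by (simp add: ln_mult ln_realpow ln_powr L_def)
    finally have "ln (E n) / L \<le> ((ln K1 + 3 * ln L) + R * L) / L" using L by (intro divide_right_mono) auto
    also have "\<dots> = R + (ln K1 + 3 * ln L) / L" using L by (simp add: add_divide_distrib)
    also have "\<dots> < R + \<epsilon>" using elim unfolding L_def by blast
    finally have U: "ln (E n) / L < R + \<epsilon>" .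
    have "ln (K2 / L ^ 3 * exp (- decay_rate \<alpha> \<gamma> L) * real n powr (2 + 2 * \<gamma> - 2 * \<delta>)) \<le> ln (E n)"
      using lo lo0 E0 by (subst ln_le_cancel_iff) auto
    moreover have "ln (K2 / L ^ 3 * exp (- decay_rate \<alpha> \<gamma> L) * real n powr (2 + 2 * \<gamma> - 2 * \<delta>))
      = (ln K2 + (-3) * ln L) - decay_rate \<alpha> \<gamma> L + (2 + 2 * \<gamma> - 2 * \<delta>) * L"
      using K L n by (simp add: ln_mult ln_div ln_realpow ln_powr L_def)
    ultimately have "((ln K2 + (-3) * ln L) - decay_rate \<alpha> \<gamma> L + (2 + 2 * \<gamma> - 2 * \<delta>) * L) / L \<le> ln (E n) / L"
      using L by (intro divide_right_mono) auto
    moreover have "((ln K2 + (-3) * ln L) - decay_rate \<alpha> \<gamma> L + (2 + 2 * \<gamma> - 2 * \<delta>) * L) / L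
      = (ln K2 + (-3) * ln L) / L - decay_rate \<alpha> \<gamma> L / L + (2 + 2 * \<gamma> - 2 * \<delta>)"
      using L by (simp add: add_divide_distrib diff_divide_distrib)
    moreover have "R - \<epsilon> < (ln K2 + (-3) * ln L) / L - decay_rate \<alpha> \<gamma> L / L + (2 + 2 * \<gamma> - 2 * \<delta>)"
      using elim unfolding L_def by blast
    ultimately have "R - \<epsilon> < ln (E n) / L" by linarith
    then show ?case using U unfolding L_def dist_real_def by linarith
  qed
  then show "\<forall>\<^sub>F n in sequentially. dist (ln (integral\<^sup>L srw_space (\<lambda>\<omega>. real (close_pairs n \<alpha> \<beta> \<omega>))) / ln (real n)) (rho2 \<alpha> \<beta>) < \<epsilon>"
    unfolding E_def R_def .
qed

end
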